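(* Let $$\triangle E=\sum_{k,k'\in\Lambda}U_{k,k'}\,\frac{C_k^2C_{k'}^2+S_k^2S_{k'}^2}{1+(\Phi,\Phi)}\sum_{p\in\Lambda}\frac{U_{k,p}U_{k',p}\,(C_k^2S_p^2+C_p^2S_k^2)(C_{k'}^2S_p^2+C_p^2S_{k'}^2)}{(E_k+E_p)(E_{k'}+E_p)}$$ $$\qquad+4\sum_{k,k'\in\Lambda}U_{k,k'}\,\frac{C_kS_kC_{k'}S_{k'}}{1+(\Phi,\Phi)}\,\frac{U_{k,k'}^2\,(C_k^2S_{k'}^2+C_{k'}^2S_k^2)^2}{(E_k+E_{k'})^2}.$$ Then the state $\Psi$ has a lower energy than the BCS state $\Psi_{BCS}$, and hence than the Fermi vacuum $\Psi_F$, i.e., $$(\Psi,H\Psi)-(\Psi_{BCS},H\Psi_{BCS})=\triangle E<0.$$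
   Context: Fix (large) real numbers $L,K_{max}>0$ and let $\Lambda=\{\frac{2\pi}{L}(n_1,n_2,n_3)\in\mathbb{R}^3: n_1,n_2,n_3\in\mathbb{Z},\ \frac{2\pi}{L}\sqrt{n_1^2+n_2^2+n_3^2}\le K_{max}\}$, a finite set with $M$ elements, whose elements are arranged in a fixed order. Let $\mathcal{H}=\mathbb{C}^{2^{2M}}$ with its standard inner product $(\cdot,\cdot)$; its standard unit vectors are labelled $|n_{k\uparrow},n_{k\downarrow},n_{k'\uparrow},n_{k'\downarrow},\ldots\rangle$ with $n_{k\sigma}\in\{0,1\}$, $k\in\Lambda$, $\sigma\in\{\uparrow,\downarrow\}$, and $|0\rangle$ denotes the one with all $n_{k\sigma}=0$. The annihilation operator $C_{k\sigma}$ is the linear operator on $\mathcal{H}$ which sends a standard unit vector with $n_{k\sigma}=1$ to $(-1)^{s}$ times the standard unit vector obtained by replacing $n_{k\sigma}$ by $0$, where $s$ is the sum of the occupation numbers to the left of $n_{k\sigma}$, and sends a standard unit vector with $n_{k\sigma}=0$ to $0$. The creation operator $C_{k\sigma}^*$ sends a standard unit vector with $n_{k\sigma}=0$ to $(-1)^{s}$ times the one with $n_{k\sigma}$ replaced by $1$ (same $s$), and one with $n_{k\sigma}=1$ to $0$; it is the adjoint of $C_{k\sigma}$. Let $m,\mu>0$ be the electron mass and the chemical potential, and $\xi_k=\hbar^2|k|^2/(2m)-\mu$. Let $U_{k,k'}$ be a function of $k,k'\in\Lambda$ with $U_{k,k'}\le 0$, $U_{k',k}=U_{k,k'}$, $U_{-k,-k'}=U_{k,k'}$,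 $U_{k,k}=0$. The BCS Hamiltonian is $$H=\sum_{k\in\Lambda,\,\sigma=\uparrow,\downarrow}\xi_kC_{k\sigma}^*C_{k\sigma}+\sum_{k,k'\in\Lambda}U_{k,k'}C_{k'\uparrow}^*C_{-k'\downarrow}^*C_{-k\downarrow}C_{k\uparrow}.$$ It is assumed that there is a function $\Delta_k\ge0$ of $k\in\Lambda$ with $\Delta_{-k}=\Delta_k$ solving the gap equation $\Delta_k=-\frac12\sum_{k'\in\Lambda}U_{k,k'}\Delta_{k'}/\sqrt{\xi_{k'}^2+\Delta_{k'}^2}$; fix such a $\Delta$. Let $\theta_k\in[0,\pi/2]$ satisfy $\sin2\theta_k=\Delta_k/\sqrt{\xi_k^2+\Delta_k^2}$, $\cos2\theta_k=\xi_k/\sqrt{\xi_k^2+\Delta_k^2}$ (when $\Delta_k=0$ for all $k\in\Lambda$, it is assumed that $\theta_k=\pi/2$ for those $k$ with $\xi_k=0$). Let $G_B=i\sum_{k\in\Lambda}\theta_k(C_{-k\downarrow}C_{k\uparrow}-C_{k\uparrow}^*C_{-k\downarrow}^* )$. The BCS state is $\Psi_{BCS}=e^{iG_B}|0\rangle$, and $\gamma_{k\sigma}=e^{iG_B}C_{k\sigma}e^{-iG_B}$ with adjoint $\gamma_{k\sigma}^*$. The Fermi vacuum (normal state) is $\Psi_F=\{\prod_{k\in\Lambda,\ \xi_k\le0}C_{k\uparrow}^*C_{-k\downarrow}^*\}|0\rangle$. Write $E_k=\sqrt{\xi_k^2+\Delta_k^2}$, and let the numbers $S_k,C_k$ be $S_k=\sin\theta_k$,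 $C_k=\cos\theta_k$. Put $$\Phi=\frac12\sum_{p,p'\in\Lambda}\frac{U_{p,p'}(C_p^2S_{p'}^2+C_{p'}^2S_p^2)}{E_p+E_{p'}}\gamma_{p\uparrow}^*\gamma_{-p\downarrow}^*\gamma_{p'\uparrow}^*\gamma_{-p'\downarrow}^*\Psi_{BCS},\qquad \Psi=\frac{\Psi_{BCS}+\Phi}{\sqrt{1+(\Phi,\Phi)}}.$$
   Formalization: The strict inequalities are claimed only if Δ is not identically 0, or some k,k' on one side of the Fermi surface and p on the other have U_{k,k'}, U_{k,p}, U_{k',p} all nonzero; otherwise △E=0 (e.g. U=0), and the printed "<0" fails. The energy identity is unconditional. *)

theory Defs
  imports "HOL-Analysis.Analysis" "HOL-Library.Function_Algebras"
begin

definition Lam :: "real \<Rightarrow> real \<Rightarrow> (real^3) set" where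
  "Lam L Kmax = {(2 * pi / L) *\<^sub>R vector [of_int n1, of_int n2, of_int n3] | n1 n2 n3 :: int.
     2 * pi / L * sqrt ((of_int n1)\<^sup>2 + (of_int n2)\<^sup>2 + (of_int n3)\<^sup>2) \<le> Kmax}"

datatype spin = Up | Dn

type_synonym mode = "(real^3) \<times> spin"

(* A standard unit vector |n_{k up}, n_{k dn}, n_{k' up}, ...> is labelled by its set of occupied
   modes, i.e. the modes with occupation number 1.  A vector is its family of coordinates with
   respect to these unit vectors; only the coordinates at labels in configs are relevant, and all
   vectors constructed below vanish at the other labels.  The list ks is the wave vectors in their
   fixed order.  With M distinct entries there are 2M modes and 2^(2M) unit vectors.
   Sums of vectors are pointwise (Function_Algebras). *)
type_synonym state = "mode set \<Rightarrow> complex"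

definition modes :: "(real^3) list \<Rightarrow> mode list" where
  "modes ks = concat (map (\<lambda>k. [(k, Up), (k, Dn)]) ks)"

definition configs :: "(real^3) list \<Rightarrow> mode set set" where
  "configs ks = Pow (set (modes ks))"

definition ket :: "mode set \<Rightarrow> state" where
  "ket n = (\<lambda>n'. if n' = n then 1 else 0)"

definition vac :: state where
  "vac = ket {}"

definition smul :: "complex \<Rightarrow> state \<Rightarrow> state"  (infixr "\<odot>" 75) where
  "a \<odot> \<psi> = (\<lambda>n. a * \<psi> n)"

definition ip :: "(real^3) list \<Rightarrow> state \<Rightarrow> state \<Rightarrow> complex" where
  "ip ks \<phi> \<psi> = (\<Sum>n\<in>configs ks. cnj (\<phi> n) * \<psi> n)"

(* the linear operator sending ket n to f n for every label n *)
definition linext :: "(real^3) list \<Rightarrow> (mode set \<Rightarrow> state) \<Rightarrow> state \<Rightarrow> state" where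
  "linext ks f \<psi> = (\<Sum>n\<in>configs ks. \<psi> n \<odot> f n)"

(* the sum of the occupation numbers to the left of mode x *)
definition occ_left :: "(real^3) list \<Rightarrow> mode set \<Rightarrow> mode \<Rightarrow> nat" where
  "occ_left ks n x = card (n \<inter> set (takeWhile (\<lambda>y. y \<noteq> x) (modes ks)))"

definition annih :: "(real^3) list \<Rightarrow> mode \<Rightarrow> state \<Rightarrow> state" where
  "annih ks x = linext ks (\<lambda>n. if x \<in> n then (-1) ^ occ_left ks n x \<odot> ket (n - {x}) else 0)"

definition creat :: "(real^3) list \<Rightarrow> mode \<Rightarrow> state \<Rightarrow> state" where
  "creat ks x = linext ks (\<lambda>n. if x \<notin> n then (-1) ^ occ_left ks n x \<odot> ket (insert x n) else 0)"

(* adjoint of a linear operator: the coordinate of A* psi at m is (ket m, A* psi) = (A ket m, psi) *)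
definition adj :: "(real^3) list \<Rightarrow> (state \<Rightarrow> state) \<Rightarrow> state \<Rightarrow> state" where
  "adj ks A \<psi> = (\<lambda>m. if m \<in> configs ks then ip ks (A (ket m)) \<psi> else 0)"

(* exponential series of a linear operator, summed coordinatewise *)
definition op_exp :: "(state \<Rightarrow> state) \<Rightarrow> state \<Rightarrow> state" where
  "op_exp A \<psi> = (\<lambda>n. \<Sum>j. (A ^^ j) \<psi> n / fact j)"

definition xi :: "real \<Rightarrow> real \<Rightarrow> real \<Rightarrow> real^3 \<Rightarrow> real" where
  "xi hbar m \<mu> k = hbar\<^sup>2 * (norm k)\<^sup>2 / (2 * m) - \<mu>"

definition Ham :: "(real^3) list \<Rightarrow> (real^3 \<Rightarrow> real) \<Rightarrow> (real^3 \<Rightarrow> real^3 \<Rightarrow> real) \<Rightarrow> state \<Rightarrow> state" where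
  "Ham ks \<xi> U \<psi> =
     (\<Sum>k\<in>set ks. \<Sum>\<sigma>\<in>{Up, Dn}. complex_of_real (\<xi> k) \<odot> creat ks (k, \<sigma>) (annih ks (k, \<sigma>) \<psi>))
   + (\<Sum>k\<in>set ks. \<Sum>k'\<in>set ks. complex_of_real (U k k') \<odot>
        creat ks (k', Up) (creat ks (-k', Dn) (annih ks (-k, Dn) (annih ks (k, Up) \<psi>))))"

definition En :: "(real^3 \<Rightarrow> real) \<Rightarrow> (real^3 \<Rightarrow> real) \<Rightarrow> real^3 \<Rightarrow> real" where
  "En \<xi> \<Delta> k = sqrt ((\<xi> k)\<^sup>2 + (\<Delta> k)\<^sup>2)"

definition G_B :: "(real^3) list \<Rightarrow> (real^3 \<Rightarrow> real) \<Rightarrow> state \<Rightarrow> state" where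
  "G_B ks \<theta> \<psi> = \<i> \<odot> (\<Sum>k\<in>set ks. complex_of_real (\<theta> k) \<odot>
     (annih ks (-k, Dn) (annih ks (k, Up) \<psi>) - creat ks (k, Up) (creat ks (-k, Dn) \<psi>)))"

definition Psi_BCS :: "(real^3) list \<Rightarrow> (real^3 \<Rightarrow> real) \<Rightarrow> state" where
  "Psi_BCS ks \<theta> = op_exp (\<lambda>\<psi>. \<i> \<odot> G_B ks \<theta> \<psi>) vac"

definition gam :: "(real^3) list \<Rightarrow> (real^3 \<Rightarrow> real) \<Rightarrow> mode \<Rightarrow> state \<Rightarrow> state" where
  "gam ks \<theta> x \<psi> =
     op_exp (\<lambda>\<phi>. \<i> \<odot> G_B ks \<theta> \<phi>) (annih ks x (op_exp (\<lambda>\<phi>. (- \<i>) \<odot> G_B ks \<theta> \<phi>) \<psi>))"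

definition gam_adj :: "(real^3) list \<Rightarrow> (real^3 \<Rightarrow> real) \<Rightarrow> mode \<Rightarrow> state \<Rightarrow> state" where
  "gam_adj ks \<theta> x = adj ks (gam ks \<theta> x)"

(* the factors commute for different k, so the order of the product does not matter *)
definition Psi_F :: "(real^3) list \<Rightarrow> (real^3 \<Rightarrow> real) \<Rightarrow> state" where
  "Psi_F ks \<xi> = foldr (\<lambda>k \<psi>. creat ks (k, Up) (creat ks (-k, Dn) \<psi>)) (filter (\<lambda>k. \<xi> k \<le> 0) ks) vac"

(* C_p^2 S_q^2 + C_q^2 S_p^2 *)
definition mix :: "(real^3 \<Rightarrow> real) \<Rightarrow> real^3 \<Rightarrow> real^3 \<Rightarrow> real" where
  "mix \<theta> p q = (cos (\<theta> p))\<^sup>2 * (sin (\<theta> q))\<^sup>2 + (cos (\<theta> q))\<^sup>2 * (sin (\<theta> p))\<^sup>2"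

(* When Delta vanishes identically, En p + En p' = 0 is possible, namely if xi p = xi p' = 0.  Then
   theta p = theta p' = pi/2 and mix is 0; such summands, here and in DeltaE, are read as 0. *)
definition Phi :: "(real^3) list \<Rightarrow> (real^3 \<Rightarrow> real) \<Rightarrow> (real^3 \<Rightarrow> real^3 \<Rightarrow> real) \<Rightarrow>
    (real^3 \<Rightarrow> real) \<Rightarrow> (real^3 \<Rightarrow> real) \<Rightarrow> state" where
  "Phi ks \<xi> U \<Delta> \<theta> = (1/2) \<odot> (\<Sum>p\<in>set ks. \<Sum>p'\<in>set ks.
     complex_of_real (U p p' * mix \<theta> p p' / (En \<xi> \<Delta> p + En \<xi> \<Delta> p')) \<odot>
       gam_adj ks \<theta> (p, Up) (gam_adj ks \<theta> (-p, Dn)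
         (gam_adj ks \<theta> (p', Up) (gam_adj ks \<theta> (-p', Dn) (Psi_BCS ks \<theta>)))))"

(* 1 + (Phi, Phi); the inner product of a vector with itself is real *)
definition nrm :: "(real^3) list \<Rightarrow> (real^3 \<Rightarrow> real) \<Rightarrow> (real^3 \<Rightarrow> real^3 \<Rightarrow> real) \<Rightarrow>
    (real^3 \<Rightarrow> real) \<Rightarrow> (real^3 \<Rightarrow> real) \<Rightarrow> real" where
  "nrm ks \<xi> U \<Delta> \<theta> = 1 + Re (ip ks (Phi ks \<xi> U \<Delta> \<theta>) (Phi ks \<xi> U \<Delta> \<theta>))"

definition Psi :: "(real^3) list \<Rightarrow> (real^3 \<Rightarrow> real) \<Rightarrow> (real^3 \<Rightarrow> real^3 \<Rightarrow> real) \<Rightarrow>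
    (real^3 \<Rightarrow> real) \<Rightarrow> (real^3 \<Rightarrow> real) \<Rightarrow> state" where
  "Psi ks \<xi> U \<Delta> \<theta> =
     complex_of_real (1 / sqrt (nrm ks \<xi> U \<Delta> \<theta>)) \<odot> (Psi_BCS ks \<theta> + Phi ks \<xi> U \<Delta> \<theta>)"

definition DeltaE :: "(real^3) list \<Rightarrow> (real^3 \<Rightarrow> real) \<Rightarrow> (real^3 \<Rightarrow> real^3 \<Rightarrow> real) \<Rightarrow>
    (real^3 \<Rightarrow> real) \<Rightarrow> (real^3 \<Rightarrow> real) \<Rightarrow> real" where
  "DeltaE ks \<xi> U \<Delta> \<theta> =
     (\<Sum>k\<in>set ks. \<Sum>k'\<in>set ks. U k k' *
        (((cos (\<theta> k))\<^sup>2 * (cos (\<theta> k'))\<^sup>2 + (sin (\<theta> k))\<^sup>2 * (sin (\<theta> k'))\<^sup>2) / nrm ks \<xi> U \<Delta> \<theta>) *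
        (\<Sum>p\<in>set ks. U k p * U k' p * mix \<theta> k p * mix \<theta> k' p /
           ((En \<xi> \<Delta> k + En \<xi> \<Delta> p) * (En \<xi> \<Delta> k' + En \<xi> \<Delta> p))))
   + 4 * (\<Sum>k\<in>set ks. \<Sum>k'\<in>set ks. U k k' *
        (cos (\<theta> k) * sin (\<theta> k) * cos (\<theta> k') * sin (\<theta> k') / nrm ks \<xi> U \<Delta> \<theta>) *
        ((U k k')\<^sup>2 * (mix \<theta> k k')\<^sup>2 / (En \<xi> \<Delta> k + En \<xi> \<Delta> k')\<^sup>2))"

definition energy :: "(real^3) list \<Rightarrow> (real^3 \<Rightarrow> real) \<Rightarrow> (real^3 \<Rightarrow> real^3 \<Rightarrow> real) \<Rightarrow> state \<Rightarrow> complex" where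
  "energy ks \<xi> U \<psi> = ip ks \<psi> (Ham ks \<xi> U \<psi>)"

(* The summands of DeltaE are all nonpositive, but all of them vanish e.g. for U = 0, so strict
   inequality needs some coupling.  This condition is exactly DeltaE \<noteq> 0: either the gap does not
   vanish identically, or (with zero gap, where the angles are 0 or pi/2) three wave vectors, two on
   one side of the Fermi surface and one on the other, are mutually coupled. *)
definition coupled :: "(real^3) list \<Rightarrow> (real^3 \<Rightarrow> real) \<Rightarrow> (real^3 \<Rightarrow> real^3 \<Rightarrow> real) \<Rightarrow>
    (real^3 \<Rightarrow> real) \<Rightarrow> bool" where
  "coupled ks \<xi> U \<Delta> \<longleftrightarrow>
     (\<exists>k\<in>set ks. \<Delta> k \<noteq> 0) \<or>
     (\<exists>k\<in>set ks. \<exists>k'\<in>set ks. \<exists>p\<in>set ks.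
        (\<xi> k \<le> 0 \<longleftrightarrow> \<xi> k' \<le> 0) \<and> (\<xi> k \<le> 0 \<longleftrightarrow> \<not> \<xi> p \<le> 0) \<and>
        U k k' \<noteq> 0 \<and> U k p \<noteq> 0 \<and> U k' p \<noteq> 0)"

end

theory Submission
  imports Defs
begin

text \<open>The generator \<open>\<i> G_B\<close> is a sum of commuting operators \<open>\<theta>\<^sub>k K\<^sub>k\<close>, where \<open>K\<^sub>k\<close> is a pair creator minus the
  corresponding pair annihilator and satisfies \<open>K\<^sup>3 = - K\<close>; hence \<open>exp (\<i> G_B)\<close> is a product of plane
  rotations, and it turns the pair operators \<open>B\<^sub>k\<close> into explicit combinations of \<open>1 - 2 B\<^sub>k\<^sup>* B\<^sub>k\<close>, \<open>B\<^sub>k\<close> and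
  \<open>B\<^sub>k\<^sup>*\<close>. Undoing the rotation, \<open>\<Psi>\<close> becomes a superposition of the vacuum and a state with exactly two
  pairs. In the rotated Hamiltonian the terms changing the number of pairs by one do not contribute,
  by parity. By the gap equation the diagonal part costs \<open>2 (E\<^sub>p + E\<^sub>q)\<close> for two pairs,
  and the amplitudes of \<open>\<Phi>\<close> are such that the interference with the vacuum cancels precisely this
  cost. What is left is the expectation of the pair hopping and pair-pair interaction in \<open>\<Phi>\<close>,
  which is \<open>\<triangle>E\<close> and is termwise nonpositive because \<open>U \<le> 0\<close>.\<close>

section \<open>Fermionic operators\<close>

lemma sum_fun_apply: "(sum F A) x = (\<Sum>a\<in>A. F a x)"
  by (induction A rule: infinite_finite_induct) auto

lemma smul_apply [simp]: "(a \<odot> \<psi>) n = a * \<psi> n"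
  by (simp add: smul_def)

lemma smul_zero [simp]: "a \<odot> 0 = 0" "0 \<odot> \<psi> = 0"
  by (auto simp: fun_eq_iff)

lemma smul_one [simp]: "1 \<odot> \<psi> = \<psi>"
  by (auto simp: fun_eq_iff)

lemma smul_smul [simp]: "a \<odot> b \<odot> \<psi> = (a * b) \<odot> \<psi>"
  by (auto simp: fun_eq_iff)

section \<open>Linear operators on states\<close>

definition lin :: "(state \<Rightarrow> state) \<Rightarrow> bool" where
  "lin A \<longleftrightarrow> (\<forall>\<phi> \<psi>. A (\<phi> + \<psi>) = A \<phi> + A \<psi>) \<and> (\<forall>a \<psi>. A (a \<odot> \<psi>) = a \<odot> A \<psi>)"

lemma lin_add: "lin A \<Longrightarrow> A (\<phi> + \<psi>) = A \<phi> + A \<psi>"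
  and lin_smul: "lin A \<Longrightarrow> A (a \<odot> \<psi>) = a \<odot> A \<psi>"
  by (auto simp: lin_def)

lemma lin_zero: "lin A \<Longrightarrow> A 0 = 0"
  using lin_smul[of A 0 0] by simp

lemma lin_uminus: "lin A \<Longrightarrow> A (- \<psi>) = - A \<psi>"
  using lin_smul[of A "-1" \<psi>]
  by (metis (no_types, opaque_lifting) lin_add lin_zero add.right_inverse add_eq_0_iff)

lemma lin_diff: "lin A \<Longrightarrow> A (\<phi> - \<psi>) = A \<phi> - A \<psi>"
  by (metis ab_group_add_class.ab_diff_conv_add_uminus lin_add lin_uminus)

lemma lin_sum: "lin A \<Longrightarrow> A (sum F S) = (\<Sum>x\<in>S. A (F x))"
  by (induction S rule: infinite_finite_induct) (auto simp: lin_zero lin_add)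

lemmas lin_rules = lin_add lin_smul lin_zero lin_uminus lin_diff lin_sum

lemma lin_comp: "lin A \<Longrightarrow> lin B \<Longrightarrow> lin (\<lambda>\<psi>. A (B \<psi>))"
  by (simp add: lin_def)

lemma lin_id: "lin (\<lambda>\<psi>. \<psi>)"
  by (simp add: lin_def)

lemma lin_scaled: "lin A \<Longrightarrow> lin (\<lambda>\<psi>. a \<odot> A \<psi>)"
  by (auto simp: lin_def fun_eq_iff algebra_simps)

lemma lin_plus: "lin A \<Longrightarrow> lin B \<Longrightarrow> lin (\<lambda>\<psi>. A \<psi> + B \<psi>)"
  by (auto simp: lin_def fun_eq_iff algebra_simps)

lemma lin_minus: "lin A \<Longrightarrow> lin B \<Longrightarrow> lin (\<lambda>\<psi>. A \<psi> - B \<psi>)"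
  by (auto simp: lin_def fun_eq_iff algebra_simps)

lemma lin_sum_ops: "(\<And>x. x \<in> S \<Longrightarrow> lin (F x)) \<Longrightarrow> lin (\<lambda>\<psi>. \<Sum>x\<in>S. F x \<psi>)"
  by (induction S rule: infinite_finite_induct)
     (auto simp: lin_plus lin_def, auto simp: fun_eq_iff algebra_simps)

lemma lin_foldr: "(\<And>x. x \<in> set xs \<Longrightarrow> lin (F x)) \<Longrightarrow> lin (foldr F xs)"
proof (induction xs)
  case Nil
  then show ?case by (simp add: lin_def)
next
  case (Cons x xs)
  then show ?case by (simp add: lin_def)
qed

lemma lin_linext: "lin (linext ks f)"
  by (auto simp: lin_def linext_def fun_eq_iff sum_fun_apply sum.distrib sum_distrib_left
      distrib_right mult.assoc)

section \<open>Sesquilinearity of the inner product\<close>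

lemma ip_add_left: "ip ks (\<phi> + \<omega>) \<psi> = ip ks \<phi> \<psi> + ip ks \<omega> \<psi>"
  and ip_add_right: "ip ks \<phi> (\<psi> + \<omega>) = ip ks \<phi> \<psi> + ip ks \<phi> \<omega>"
  and ip_diff_left: "ip ks (\<phi> - \<omega>) \<psi> = ip ks \<phi> \<psi> - ip ks \<omega> \<psi>"
  and ip_diff_right: "ip ks \<phi> (\<psi> - \<omega>) = ip ks \<phi> \<psi> - ip ks \<phi> \<omega>"
  and ip_smul_left: "ip ks (a \<odot> \<phi>) \<psi> = cnj a * ip ks \<phi> \<psi>"
  and ip_smul_right: "ip ks \<phi> (a \<odot> \<psi>) = a * ip ks \<phi> \<psi>"
  and ip_zero_left: "ip ks 0 \<psi> = 0"
  and ip_zero_right: "ip ks \<phi> 0 = 0"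
  and ip_uminus_left: "ip ks (- \<phi>) \<psi> = - ip ks \<phi> \<psi>"
  and ip_uminus_right: "ip ks \<phi> (- \<psi>) = - ip ks \<phi> \<psi>"
  by (auto simp: ip_def algebra_simps sum.distrib sum_distrib_left sum_subtractf sum_negf)

lemma ip_sum_left: "ip ks (sum F A) \<psi> = (\<Sum>x\<in>A. ip ks (F x) \<psi>)"
  by (induction A rule: infinite_finite_induct) (simp_all only: sum.infinite sum.empty sum.insert ip_add_left ip_zero_left not_False_eq_True)

lemma ip_sum_right: "ip ks \<phi> (sum F A) = (\<Sum>x\<in>A. ip ks \<phi> (F x))"
  by (induction A rule: infinite_finite_induct) (simp_all only: sum.infinite sum.empty sum.insert ip_add_right ip_zero_right not_False_eq_True)

lemmas ip_rules = ip_add_left ip_add_right ip_diff_left ip_diff_right ip_smul_left ip_smul_right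
  ip_zero_left ip_zero_right ip_uminus_left ip_uminus_right

lemma ip_cnj: "cnj (ip ks \<phi> \<psi>) = ip ks \<psi> \<phi>"
  by (simp add: ip_def mult.commute)

section \<open>Labels and fermionic signs\<close>

lemma set_modes [simp]: "(k, \<sigma>) \<in> set (modes ks) \<longleftrightarrow> k \<in> set ks"
  by (cases \<sigma>) (auto simp: modes_def)

lemma finite_configs [simp]: "finite (configs ks)"
  by (simp add: configs_def)

lemma config_finite: "m \<in> configs ks \<Longrightarrow> finite m"
  by (auto simp: configs_def intro: finite_subset)

lemma insert_config [simp]: "x \<in> set (modes ks) \<Longrightarrow> insert x m \<in> configs ks \<longleftrightarrow> m \<in> configs ks"
  by (auto simp: configs_def)

lemma diff_config [simp]: "x \<in> set (modes ks) \<Longrightarrow> m - {x} \<in> configs ks \<longleftrightarrow> m \<in> configs ks"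
  by (auto simp: configs_def)

lemma empty_config [simp]: "{} \<in> configs ks"
  by (simp add: configs_def)

definition sgn_left :: "(real^3) list \<Rightarrow> mode set \<Rightarrow> mode \<Rightarrow> complex" where
  "sgn_left ks m x = (-1) ^ occ_left ks m x"

text \<open>The factor by which toggling the occupation of \<open>y\<close> changes the sign
  attached to \<open>x\<close>. Factoring signs in this way reduces the anticommutation relations to
  \<open>flip_swap\<close>.\<close>

definition flip :: "(real^3) list \<Rightarrow> mode \<Rightarrow> mode \<Rightarrow> complex" where
  "flip ks y x = (if y \<in> set (takeWhile (\<lambda>z. z \<noteq> x) (modes ks)) then -1 else 1)"

lemma flip_self [simp]: "flip ks x x = 1"
  using set_takeWhileD by (fastforce simp: flip_def)

lemma flip_square [simp]: "flip ks x y * flip ks x y = 1"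
  by (simp add: flip_def)

text \<open>Only first occurrences matter to \<open>takeWhile\<close>, and of two distinct entries
  exactly one occurs first.\<close>

lemma takeWhile_precedes:
  "x \<noteq> y \<Longrightarrow> x \<in> set xs \<Longrightarrow> y \<in> set xs \<Longrightarrow>
   x \<in> set (takeWhile (\<lambda>z. z \<noteq> y) xs) \<longleftrightarrow> y \<notin> set (takeWhile (\<lambda>z. z \<noteq> x) xs)"
proof (induction xs)
  case (Cons a xs)
  then show ?case by (cases "a = x"; cases "a = y") (auto dest: set_takeWhileD)
qed simp

lemma flip_swap:
  "x \<noteq> y \<Longrightarrow> x \<in> set (modes ks) \<Longrightarrow> y \<in> set (modes ks) \<Longrightarrow> flip ks x y = - flip ks y x"
  using takeWhile_precedes[of x y "modes ks"] by (auto simp: flip_def)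

lemma sgn_left_square [simp]: "sgn_left ks m x * sgn_left ks m x = 1"
  by (simp add: sgn_left_def flip: power_add mult_2)

lemma sgn_left_insert: "y \<notin> m \<Longrightarrow> sgn_left ks (insert y m) x = flip ks y x * sgn_left ks m x"
  by (auto simp: sgn_left_def flip_def occ_left_def Int_insert_left)

lemma sgn_left_delete: "y \<in> m \<Longrightarrow> sgn_left ks (m - {y}) x = flip ks y x * sgn_left ks m x"
  using sgn_left_insert[of y "m - {y}" ks x]
  by (simp add: insert_absorb flip: mult.assoc)

lemma cnj_sgn_left [simp]: "cnj (sgn_left ks m x) = sgn_left ks m x"
  by (simp add: sgn_left_def)

section \<open>Coordinates, adjoints and anticommutation of the creation and annihilation
  operators\<close>

lemma lin_annih: "lin (annih ks x)" and lin_creat: "lin (creat ks x)"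
  by (simp_all add: annih_def creat_def lin_linext)

text \<open>Only the label \<open>insert x m\<close> contributes to the coordinate at
  \<open>m\<close>. Its sign may be read off at \<open>m\<close>, since a mode does not lie to the
  left of itself.\<close>

lemma annih_apply:
  assumes "x \<in> set (modes ks)"
  shows "annih ks x \<psi> m =
    (if m \<in> configs ks \<and> x \<notin> m then sgn_left ks m x * \<psi> (insert x m) else 0)"
proof -
  have "annih ks x \<psi> m = (\<Sum>n\<in>configs ks. if n = insert x m \<and> x \<notin> m
      then sgn_left ks m x * \<psi> n else 0)"
    unfolding annih_def linext_def sum_fun_apply
    by (intro sum.cong refl) (auto simp: ket_def sgn_left_insert mult_ac simp flip: sgn_left_def)
  also have "\<dots> = (if m \<in> configs ks \<and> x \<notin> m then sgn_left ks m x * \<psi> (insert x m) else 0)"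
    using assms by (cases "x \<notin> m") (simp_all add: sum.delta)
  finally show ?thesis .
qed

lemma creat_apply:
  assumes "x \<in> set (modes ks)"
  shows "creat ks x \<psi> m =
    (if m \<in> configs ks \<and> x \<in> m then sgn_left ks m x * \<psi> (m - {x}) else 0)"
proof -
  have "creat ks x \<psi> m = (\<Sum>n\<in>configs ks. if n = m - {x} \<and> x \<in> m
      then sgn_left ks m x * \<psi> n else 0)"
    unfolding creat_def linext_def sum_fun_apply
    by (intro sum.cong refl) (auto simp: ket_def sgn_left_insert mult_ac simp flip: sgn_left_def)
  also have "\<dots> = (if m \<in> configs ks \<and> x \<in> m then sgn_left ks m x * \<psi> (m - {x}) else 0)"
    using assms by (cases "x \<in> m") (simp_all add: sum.delta)
  finally show ?thesis .
qed

text \<open>Toggling \<open>x\<close> is a bijection between the labels with and without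
  \<open>x\<close>, and it leaves the sign at \<open>x\<close> unchanged because
  \<open>flip ks x x = 1\<close>.\<close>

lemma ip_creat_left:
  assumes "x \<in> set (modes ks)"
  shows "ip ks (creat ks x \<phi>) \<psi> = ip ks \<phi> (annih ks x \<psi>)"
proof -
  have "ip ks (creat ks x \<phi>) \<psi> =
      (\<Sum>m\<in>{m \<in> configs ks. x \<in> m}. sgn_left ks m x * cnj (\<phi> (m - {x})) * \<psi> m)"
    unfolding ip_def using assms
    by (intro sum.mono_neutral_cong_right) (auto simp: creat_apply)
  also have "\<dots> = (\<Sum>m\<in>{m \<in> configs ks. x \<notin> m}. sgn_left ks m x * cnj (\<phi> m) * \<psi> (insert x m))"
    using assms
    by (intro sum.reindex_bij_witness[of _ "insert x" "\<lambda>m. m - {x}"])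
       (auto simp: insert_absorb sgn_left_delete)
  also have "\<dots> = ip ks \<phi> (annih ks x \<psi>)"
    unfolding ip_def using assms
    by (intro sum.mono_neutral_cong_left) (auto simp: annih_apply)
  finally show ?thesis .
qed

lemma ip_annih_left:
  "x \<in> set (modes ks) \<Longrightarrow> ip ks (annih ks x \<phi>) \<psi> = ip ks \<phi> (creat ks x \<psi>)"
  by (metis ip_cnj ip_creat_left)

text \<open>Both orders read the same coordinate of \<open>\<psi>\<close>; one leaves the factor
  \<open>flip ks x y\<close>, the other \<open>flip ks y x\<close>, and these are opposite. The same
  count settles the next two relations.\<close>

lemma annih_anticommute:
  assumes "x \<noteq> y" "x \<in> set (modes ks)" "y \<in> set (modes ks)"
  shows "annih ks x (annih ks y \<psi>) = - annih ks y (annih ks x \<psi>)"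
  using assms flip_swap[OF assms]
  by (auto simp: fun_eq_iff annih_apply sgn_left_insert insert_commute mult_ac)

lemma creat_anticommute:
  assumes "x \<noteq> y" "x \<in> set (modes ks)" "y \<in> set (modes ks)"
  shows "creat ks x (creat ks y \<psi>) = - creat ks y (creat ks x \<psi>)"
  using assms flip_swap[OF assms]
  by (auto simp: fun_eq_iff creat_apply sgn_left_delete Diff_insert2[symmetric] insert_commute mult_ac)

lemma annih_creat_anticommute:
  assumes "x \<noteq> y" "x \<in> set (modes ks)" "y \<in> set (modes ks)"
  shows "annih ks x (creat ks y \<psi>) = - creat ks y (annih ks x \<psi>)"
  using assms flip_swap[OF assms]
  by (auto simp: fun_eq_iff annih_apply creat_apply sgn_left_insert sgn_left_delete insert_Diff_if mult_ac)

lemma creat_annih_self_apply: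
  "x \<in> set (modes ks) \<Longrightarrow>
   creat ks x (annih ks x \<psi>) m = (if m \<in> configs ks \<and> x \<in> m then \<psi> m else 0)"
  by (auto simp: annih_apply creat_apply sgn_left_delete insert_absorb simp flip: mult.assoc)

lemma annih_creat_self_apply:
  "x \<in> set (modes ks) \<Longrightarrow>
   annih ks x (creat ks x \<psi>) m = (if m \<in> configs ks \<and> x \<notin> m then \<psi> m else 0)"
  by (auto simp: annih_apply creat_apply sgn_left_insert simp flip: mult.assoc)

section \<open>Exponentials of commuting rotations and the pair operators\<close>

text \<open>Carrying two operators past two others costs four sign changes, which cancel.\<close>

lemma pairwise_anticommute_commute:
  assumes "lin D1" "lin D2" "lin E1"
    and "\<And>\<psi>. D1 (E1 \<psi>) = - E1 (D1 \<psi>)" "\<And>\<psi>. D1 (E2 \<psi>) = - E2 (D1 \<psi>)"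
    and "\<And>\<psi>. D2 (E1 \<psi>) = - E1 (D2 \<psi>)" "\<And>\<psi>. D2 (E2 \<psi>) = - E2 (D2 \<psi>)"
  shows "D1 (D2 (E1 (E2 \<psi>))) = E1 (E2 (D1 (D2 \<psi>)))"
  by (simp add: assms(4-7) assms(1-3)[THEN lin_uminus])

text \<open>A spectral decomposition by hand: the polynomial \<open>x^3 + x\<close> annihilates each
  \<open>K k\<close> and has the simple roots 0, \<i> and -\<i>, so every vector splits into three
  eigenvectors of \<open>K k\<close>. Splitting for one \<open>k\<close> after the other yields
  joint eigenvectors, since the operators commute.\<close>

lemma joint_eigenvector_induct:
  fixes K :: "'b \<Rightarrow> state \<Rightarrow> state"
  assumes lin: "\<And>k. k \<in> set xs \<Longrightarrow> lin (K k)"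
    and commute: "\<And>j k \<psi>. j \<in> set xs \<Longrightarrow> k \<in> set xs \<Longrightarrow> K j (K k \<psi>) = K k (K j \<psi>)"
    and cube: "\<And>k \<psi>. k \<in> set xs \<Longrightarrow> K k (K k (K k \<psi>)) = - K k \<psi>"
    and add: "\<And>\<phi> \<psi>. P \<phi> \<Longrightarrow> P \<psi> \<Longrightarrow> P (\<phi> + \<psi>)"
    and eigen: "\<And>v. (\<And>k. k \<in> set xs \<Longrightarrow> \<exists>l\<in>{0, \<i>, -\<i>}. K k v = l \<odot> v) \<Longrightarrow> P v"
  shows "P \<psi>"
  using lin commute cube eigen
proof (induction xs arbitrary: \<psi>)
  case Nil
  then show ?case by simp
next
  case (Cons k xs)
  have linK: "lin (K k)" by (simp add: Cons.prems)
  have cubeK: "K k (K k (K k \<psi>)) = - K k \<psi>" for \<psi> by (rule Cons.prems(3)) simp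
  show ?case
  proof (rule Cons.IH)
    fix v assume v: "\<And>j. j \<in> set xs \<Longrightarrow> \<exists>l\<in>{0, \<i>, -\<i>}. K j v = l \<odot> v"
    \<comment> \<open>A polynomial in \<open>K k\<close> commutes with every \<open>K j\<close>, so
      applying it to \<open>v\<close> keeps all eigenvalues already arranged.\<close>
    have eig: "P (a \<odot> v + b \<odot> K k v + c \<odot> K k (K k v))"
      if "\<exists>l\<in>{0, \<i>, -\<i>}. K k (a \<odot> v + b \<odot> K k v + c \<odot> K k (K k v))
        = l \<odot> (a \<odot> v + b \<odot> K k v + c \<odot> K k (K k v))" for a b c
    proof (rule Cons.prems(4))
      fix j assume j: "j \<in> set (k # xs)"
      show "\<exists>l\<in>{0, \<i>, -\<i>}. K j (a \<odot> v + b \<odot> K k v + c \<odot> K k (K k v))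
        = l \<odot> (a \<odot> v + b \<odot> K k v + c \<odot> K k (K k v))"
      proof (cases "j = k")
        case True
        then show ?thesis using that by simp
      next
        case False
        with j have j: "j \<in> set xs" by simp
        from v[OF j] obtain l where l: "l \<in> {0, \<i>, -\<i>}" "K j v = l \<odot> v" by blast
        have linj: "lin (K j)" by (simp add: Cons.prems j)
        have com: "K j (K k \<psi>) = K k (K j \<psi>)" for \<psi> by (rule Cons.prems(2)) (simp_all add: j)
        have "K j (a \<odot> v + b \<odot> K k v + c \<odot> K k (K k v))
          = l \<odot> (a \<odot> v + b \<odot> K k v + c \<odot> K k (K k v))"
          by (simp add: lin_rules[OF linj] com l(2) lin_rules[OF linK])
             (simp add: fun_eq_iff algebra_simps)
        with l(1) show ?thesis by blast
      qed
    qed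
    \<comment> \<open>The three vectors are the Lagrange projections of \<open>v\<close>, given by
      the polynomials \<open>1 + x^2\<close>, \<open>x (x + \<i>) / (-2)\<close> and
      \<open>x (x - \<i>) / (-2)\<close>, for the eigenvalues 0, \<i> and -\<i>; they add up to
      \<open>v\<close>.\<close>
    have P0: "P (1 \<odot> v + 0 \<odot> K k v + 1 \<odot> K k (K k v))"
      by (rule eig, rule bexI[of _ 0])
         (simp_all add: lin_rules[OF linK] cubeK)
    have P1: "P (0 \<odot> v + (-\<i>/2) \<odot> K k v + (-1/2) \<odot> K k (K k v))"
      by (rule eig, rule bexI[of _ "\<i>"])
         (simp_all add: lin_rules[OF linK] cubeK, simp add: fun_eq_iff algebra_simps)
    have P2: "P (0 \<odot> v + (\<i>/2) \<odot> K k v + (-1/2) \<odot> K k (K k v))"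
      by (rule eig, rule bexI[of _ "-\<i>"])
         (simp_all add: lin_rules[OF linK] cubeK, simp add: fun_eq_iff algebra_simps)
    have v_eq: "v = (1 \<odot> v + 0 \<odot> K k v + 1 \<odot> K k (K k v))
      + ((0 \<odot> v + (-\<i>/2) \<odot> K k v + (-1/2) \<odot> K k (K k v))
      + (0 \<odot> v + (\<i>/2) \<odot> K k v + (-1/2) \<odot> K k (K k v)))"
      by (simp add: fun_eq_iff algebra_simps)
    show "P v" by (subst v_eq) (rule add[OF P0 add[OF P1 P2]])
  qed (use Cons.prems in auto)
qed

text \<open>Rodrigues' formula: for \<open>K^3 = - K\<close> this is the exponential of
  \<open>t K\<close>.\<close>

definition rot :: "real \<Rightarrow> (state \<Rightarrow> state) \<Rightarrow> state \<Rightarrow> state" where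
  "rot t K \<psi> = \<psi> + complex_of_real (sin t) \<odot> K \<psi> + complex_of_real (1 - cos t) \<odot> K (K \<psi>)"

lemma lin_rot: "lin K \<Longrightarrow> lin (rot t K)"
  unfolding rot_def[abs_def] by (rule lin_plus[OF lin_plus[OF lin_id lin_scaled] lin_scaled[OF lin_comp]])

lemma rot_eigenvector:
  assumes "lin K" "K v = l \<odot> v" "l \<in> {0, \<i>, -\<i>}"
  shows "rot t K v = exp (of_real t * l) \<odot> v"
proof -
  have "exp (of_real t * \<i>) = cos t + \<i> * sin t" "exp (- (of_real t * \<i>)) = cos t - \<i> * sin t"
    using cis_conv_exp[of t] cis_conv_exp[of "-t"] by (simp_all add: complex_eq_iff mult.commute)
  \<comment> \<open>The quadratic polynomial in \<open>l\<close> interpolates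
    \<open>exp (t l)\<close> at the three possible eigenvalues.\<close>
  then have scalar: "1 + of_real (sin t) * l + of_real (1 - cos t) * (l * l) = exp (of_real t * l)"
    using assms(3) by auto
  have "rot t K v = (1 + of_real (sin t) * l + of_real (1 - cos t) * (l * l)) \<odot> v"
    unfolding rot_def assms(2) lin_smul[OF assms(1)]
    by (rule ext) (simp add: algebra_simps)
  then show ?thesis unfolding scalar .
qed

lemma rot_minus_rot:
  assumes "lin K" "\<And>\<psi>. K (K (K \<psi>)) = - K \<psi>"
  shows "rot (- t) K (rot t K \<psi>) = \<psi>"
proof -
  have "cos t * cos t = 1 - sin t * sin t"
    using sin_cos_squared_add3[of t] by linarith
  then have c: "complex_of_real (cos t) * complex_of_real (cos t)
      = 1 - complex_of_real (sin t) * complex_of_real (sin t)"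
    by (metis of_real_mult of_real_diff of_real_1)
  have c': "complex_of_real (cos t) * (complex_of_real (cos t) * z)
      = z - complex_of_real (sin t) * (complex_of_real (sin t) * z)" for z
    unfolding mult.assoc[symmetric] c by (simp add: algebra_simps)
  show ?thesis
    unfolding rot_def
    by (simp add: lin_rules[OF assms(1)] assms(2)) (rule ext, simp add: algebra_simps c c')
qed

text \<open>As \<open>K\<close> is skew-adjoint, its square is symmetric, so only the sine term
  changes sign.\<close>

lemma ip_rot:
  assumes "\<And>\<phi> \<psi>. ip ks (K \<phi>) \<psi> = - ip ks \<phi> (K \<psi>)"
  shows "ip ks (rot t K \<phi>) \<psi> = ip ks \<phi> (rot (- t) K \<psi>)"
  by (simp add: rot_def ip_rules assms)

lemma rot_commute_op:
  assumes "lin A" "\<And>\<psi>. A (K \<psi>) = K (A \<psi>)"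
  shows "A (rot t K \<psi>) = rot t K (A \<psi>)"
  by (simp add: rot_def lin_rules[OF assms(1)] assms(2))

lemma foldr_commute_op:
  assumes "\<And>k \<psi>. k \<in> set xs \<Longrightarrow> A (F k \<psi>) = F k (A \<psi>)"
  shows "A (foldr F xs \<psi>) = foldr F xs (A \<psi>)"
  using assms by (induction xs) auto

text \<open>On joint eigenvectors of the \<open>K k\<close> the exponential series is scalar, and \<open>K k ^ 3 = - K k\<close> makes
  every vector a sum of such eigenvectors, with eigenvalues \<open>0\<close>, \<open>\<i>\<close> and \<open>- \<i>\<close>.\<close>

lemma op_exp_eq_foldr_rot:
  fixes K :: "'b \<Rightarrow> state \<Rightarrow> state" and \<theta> :: "'b \<Rightarrow> real"
  assumes dist: "distinct xs"
    and lin: "\<And>k. k \<in> set xs \<Longrightarrow> lin (K k)"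
    and commute: "\<And>j k \<psi>. j \<in> set xs \<Longrightarrow> k \<in> set xs \<Longrightarrow> K j (K k \<psi>) = K k (K j \<psi>)"
    and cube: "\<And>k \<psi>. k \<in> set xs \<Longrightarrow> K k (K k (K k \<psi>)) = - K k \<psi>"
  shows "op_exp (\<lambda>\<psi>. \<Sum>k\<in>set xs. complex_of_real (\<theta> k) \<odot> K k \<psi>) \<psi>
    = foldr (\<lambda>k. rot (\<theta> k) (K k)) xs \<psi>"
proof -
  define A where "A = (\<lambda>\<psi>. \<Sum>k\<in>set xs. complex_of_real (\<theta> k) \<odot> K k \<psi>)"
  define V where "V = foldr (\<lambda>k. rot (\<theta> k) (K k)) xs"
  have linA: "lin A"
    unfolding A_def by (intro lin_sum_ops lin_scaled lin)
  then have linAj: "lin (A ^^ j)" for j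
    by (induction j) (auto simp: lin_def)
  have linV: "lin V"
    unfolding V_def by (intro lin_foldr lin_rot lin)
  \<comment> \<open>Convergence is part of the predicate, not only the value of the series: this is
    what makes it closed under addition.\<close>
  define P where "P = (\<lambda>\<psi>. \<forall>n. (\<lambda>j. (A ^^ j) \<psi> n / fact j) sums V \<psi> n)"
  have "P \<psi>"
  proof (rule joint_eigenvector_induct[of xs K P, OF lin commute cube])
    fix \<phi> \<psi> assume "P \<phi>" "P \<psi>"
    then show "P (\<phi> + \<psi>)"
      unfolding P_def by (auto simp: lin_add[OF linAj] lin_add[OF linV] add_divide_distrib intro: sums_add)
  next
    fix v assume "\<And>k. k \<in> set xs \<Longrightarrow> \<exists>l\<in>{0, \<i>, -\<i>}. K k v = l \<odot> v"
    then obtain l where l: "\<And>k. k \<in> set xs \<Longrightarrow> l k \<in> {0, \<i>, -\<i>} \<and> K k v = l k \<odot> v"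
      by metis
    define s where "s = (\<Sum>k\<in>set xs. complex_of_real (\<theta> k) * l k)"
    have "A v = s \<odot> v"
      by (simp add: A_def s_def l fun_eq_iff sum_fun_apply sum_distrib_right)
    then have Aj: "(A ^^ j) v = s ^ j \<odot> v" for j
      by (induction j) (simp_all add: lin_smul[OF linA] mult.commute)
    \<comment> \<open>Stated for sublists of \<open>xs\<close>, so that the induction keeps the
      eigenvalues chosen for all of \<open>xs\<close>.\<close>
    have "foldr (\<lambda>k. rot (\<theta> k) (K k)) ys v = exp (\<Sum>k\<in>set ys. complex_of_real (\<theta> k) * l k) \<odot> v"
      if "set ys \<subseteq> set xs" "distinct ys" for ys
      using that
    proof (induction ys)
      case (Cons k ys)
      have k: "k \<in> set xs" using Cons.prems by simp
      have IH: "foldr (\<lambda>k. rot (\<theta> k) (K k)) ys v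
          = exp (\<Sum>k\<in>set ys. complex_of_real (\<theta> k) * l k) \<odot> v"
        by (rule Cons.IH) (use Cons.prems in auto)
      have "rot (\<theta> k) (K k) v = exp (of_real (\<theta> k) * l k) \<odot> v"
        using rot_eigenvector lin l k by blast
      then show ?case
        unfolding foldr.simps comp_apply IH lin_smul[OF lin_rot[OF lin[OF k]]]
        using Cons.prems by (simp add: exp_add mult.commute)
    qed simp
    then have "V v = exp s \<odot> v"
      using dist by (simp add: V_def s_def)
    moreover have "(\<lambda>j. s ^ j * v n / fact j) sums (exp s * v n)" for n
      using sums_mult2[OF exp_converges[of s], of "v n"]
      by (simp add: scaleR_conv_of_real divide_inverse mult_ac)
    ultimately show "P v"
      by (simp add: P_def Aj)
  qed
  then show ?thesis
    unfolding P_def op_exp_def A_def[symmetric] V_def[symmetric]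
    by (simp add: fun_eq_iff sums_iff)
qed

section \<open>Pair operators on a set of wave vectors closed under negation\<close>

locale fermi_modes =
  fixes ks :: "(real^3) list"
  assumes distinct_ks: "distinct ks"
    and uminus_ks: "k \<in> set ks \<Longrightarrow> - k \<in> set ks"
begin

definition B :: "real^3 \<Rightarrow> state \<Rightarrow> state" where
  "B k \<psi> = annih ks (-k, Dn) (annih ks (k, Up) \<psi>)"

definition Bc :: "real^3 \<Rightarrow> state \<Rightarrow> state" where
  "Bc k \<psi> = creat ks (k, Up) (creat ks (-k, Dn) \<psi>)"

definition K :: "real^3 \<Rightarrow> state \<Rightarrow> state" where
  "K k \<psi> = Bc k \<psi> - B k \<psi>"

lemma lin_B: "lin (B k)" and lin_Bc: "lin (Bc k)"
  unfolding B_def[abs_def] Bc_def[abs_def]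
  by (rule lin_comp[OF lin_annih lin_annih], rule lin_comp[OF lin_creat lin_creat])

lemma lin_K: "lin (K k)"
  unfolding K_def[abs_def] by (rule lin_minus[OF lin_Bc lin_B])

lemmas lin_B_rules = lin_rules[OF lin_B] lin_rules[OF lin_Bc]

context
  fixes k assumes k: "k \<in> set ks"
begin

lemma ip_B_left: "ip ks (B k \<phi>) \<psi> = ip ks \<phi> (Bc k \<psi>)"
  by (simp add: B_def Bc_def ip_annih_left k uminus_ks)

lemma ip_Bc_left: "ip ks (Bc k \<phi>) \<psi> = ip ks \<phi> (B k \<psi>)"
  by (simp add: B_def Bc_def ip_creat_left k uminus_ks)

lemma ip_K_left: "ip ks (K k \<phi>) \<psi> = - ip ks \<phi> (K k \<psi>)"
  by (simp add: K_def ip_rules ip_B_left ip_Bc_left)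

lemma B_apply:
  "B k \<psi> m = (if m \<in> configs ks \<and> (k, Up) \<notin> m \<and> (-k, Dn) \<notin> m
    then sgn_left ks m (-k, Dn) * sgn_left ks m (k, Up) * flip ks (-k, Dn) (k, Up)
      * \<psi> (insert (k, Up) (insert (-k, Dn) m)) else 0)"
  by (auto simp: B_def annih_apply k uminus_ks sgn_left_insert)

lemma Bc_apply:
  "Bc k \<psi> m = (if m \<in> configs ks \<and> (k, Up) \<in> m \<and> (-k, Dn) \<in> m
    then sgn_left ks m (k, Up) * sgn_left ks m (-k, Dn) * flip ks (k, Up) (-k, Dn)
      * \<psi> (m - {(k, Up), (-k, Dn)}) else 0)"
  by (auto simp: Bc_def creat_apply k uminus_ks sgn_left_delete Diff_insert2[symmetric])

text \<open>Reordering brings each annihilator next to the creator of its own mode. The two sign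
  changes cancel, and what remains is the projection onto labels with both modes of the pair
  empty.\<close>

lemma B_Bc_apply:
  "B k (Bc k \<psi>) m =
    (if m \<in> configs ks \<and> (k, Up) \<notin> m \<and> (-k, Dn) \<notin> m then \<psi> m else 0)"
proof -
  have "B k (Bc k \<psi>) =
      annih ks (-k, Dn) (creat ks (-k, Dn) (annih ks (k, Up) (creat ks (k, Up) \<psi>)))"
    by (simp add: B_def Bc_def creat_anticommute[of "(k, Up)" "(-k, Dn)"]
        annih_creat_anticommute[of "(k, Up)" "(-k, Dn)"] lin_uminus[OF lin_annih] k uminus_ks)
  then show ?thesis by (simp add: annih_creat_self_apply k uminus_ks)
qed

lemma Bc_B_apply:
  "Bc k (B k \<psi>) m =
    (if m \<in> configs ks \<and> (k, Up) \<in> m \<and> (-k, Dn) \<in> m then \<psi> m else 0)"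
proof -
  have "annih ks (-k, Dn) (annih ks (k, Up) \<psi>) = - annih ks (k, Up) (annih ks (-k, Dn) \<psi>)"
    "creat ks (-k, Dn) (annih ks (k, Up) \<phi>) = - annih ks (k, Up) (creat ks (-k, Dn) \<phi>)" for \<phi>
    by (subst annih_anticommute annih_creat_anticommute; simp add: k uminus_ks)+
  then have "Bc k (B k \<psi>) =
      creat ks (k, Up) (annih ks (k, Up) (creat ks (-k, Dn) (annih ks (-k, Dn) \<psi>)))"
    by (simp add: B_def Bc_def lin_uminus[OF lin_creat])
  then show ?thesis by (simp add: creat_annih_self_apply k uminus_ks)
qed

lemma B_B [simp]: "B k (B k \<psi>) = 0"
  by (auto simp: fun_eq_iff B_apply)

lemma Bc_Bc [simp]: "Bc k (Bc k \<psi>) = 0"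
  by (auto simp: fun_eq_iff Bc_apply)

lemma Bc_B_Bc [simp]: "Bc k (B k (Bc k \<psi>)) = Bc k \<psi>"
  by (rule ext, subst Bc_B_apply) (simp add: Bc_apply)

lemma B_Bc_B [simp]: "B k (Bc k (B k \<psi>)) = B k \<psi>"
  by (rule ext, subst B_Bc_apply) (simp add: B_apply)

lemma K_K: "K k (K k \<psi>) = - (Bc k (B k \<psi>) + B k (Bc k \<psi>))"
  by (simp add: K_def lin_B_rules)

text \<open>By \<open>K_K\<close> the square of \<open>K k\<close> is minus the projection onto
  labels where the pair is entirely full or entirely empty, and this projection fixes the range of
  \<open>K k\<close>.\<close>

lemma K_cube: "K k (K k (K k \<psi>)) = - K k \<psi>"
  by (simp add: K_def lin_B_rules)

end

context
  fixes j k assumes jk: "j \<in> set ks" "k \<in> set ks" "j \<noteq> k"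
begin

text \<open>Distinct \<open>j\<close> and \<open>k\<close> give four distinct modes, so every
  exchange of single operators is an anticommutation, and there are four of them.\<close>

lemma B_commute: "B j (B k \<psi>) = B k (B j \<psi>)"
  unfolding B_def
  by (rule pairwise_anticommute_commute[of "annih ks (-j, Dn)" "annih ks (j, Up)" "annih ks (-k, Dn)" "annih ks (k, Up)"];
      (rule lin_annih)?; (rule annih_anticommute)?; use jk uminus_ks in auto)

lemma Bc_commute: "Bc j (Bc k \<psi>) = Bc k (Bc j \<psi>)"
  unfolding Bc_def
  by (rule pairwise_anticommute_commute[of "creat ks (j, Up)" "creat ks (-j, Dn)" "creat ks (k, Up)" "creat ks (-k, Dn)"];
      (rule lin_creat)?; (rule creat_anticommute)?; use jk uminus_ks in auto)

lemma B_Bc_commute: "B j (Bc k \<psi>) = Bc k (B j \<psi>)"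
  unfolding B_def Bc_def
  by (rule pairwise_anticommute_commute[of "annih ks (-j, Dn)" "annih ks (j, Up)" "creat ks (k, Up)" "creat ks (-k, Dn)"];
      (rule lin_annih lin_creat)?; (rule annih_creat_anticommute)?; use jk uminus_ks in auto)

end

lemma B_K_commute: "j \<in> set ks \<Longrightarrow> k \<in> set ks \<Longrightarrow> j \<noteq> k \<Longrightarrow> B j (K k \<psi>) = K k (B j \<psi>)"
  by (simp add: K_def lin_B_rules B_Bc_commute B_commute)

lemma Bc_K_commute: "j \<in> set ks \<Longrightarrow> k \<in> set ks \<Longrightarrow> j \<noteq> k \<Longrightarrow> Bc j (K k \<psi>) = K k (Bc j \<psi>)"
  by (simp add: K_def lin_B_rules B_Bc_commute[of k j] Bc_commute[of j k])

lemma K_commute: "j \<in> set ks \<Longrightarrow> k \<in> set ks \<Longrightarrow> K j (K k \<psi>) = K k (K j \<psi>)"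
  by (cases "j = k")
     (simp_all add: K_def[of j] B_K_commute Bc_K_commute lin_diff[OF lin_K])

section \<open>The exponential of the generator as a unitary product of rotations\<close>

definition V :: "(real^3 \<Rightarrow> real) \<Rightarrow> state \<Rightarrow> state" where
  "V \<theta> = foldr (\<lambda>k. rot (\<theta> k) (K k)) ks"

lemma lin_V: "lin (V \<theta>)"
  unfolding V_def by (intro lin_foldr lin_rot lin_K)

lemma op_exp_G_B:
  "op_exp (\<lambda>\<phi>. \<i> \<odot> G_B ks \<theta> \<phi>) \<psi> = V \<theta> \<psi>"
  "op_exp (\<lambda>\<phi>. (- \<i>) \<odot> G_B ks \<theta> \<phi>) \<psi> = V (\<lambda>k. - \<theta> k) \<psi>"
proof -
  have exp_V: "op_exp (\<lambda>\<psi>. \<Sum>k\<in>set ks. complex_of_real (\<theta> k) \<odot> K k \<psi>) \<psi> = V \<theta> \<psi>" for \<theta>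
    unfolding V_def
    by (rule op_exp_eq_foldr_rot[OF distinct_ks lin_K K_commute K_cube])
  \<comment> \<open>\<open>G_B\<close> carries \<open>B - Bc\<close>, which is minus
    \<open>K\<close>; the further factor \<i> in the exponent undoes this sign.\<close>
  have G: "G_B ks \<theta> \<phi> = \<i> \<odot> (\<Sum>k\<in>set ks. complex_of_real (- \<theta> k) \<odot> K k \<phi>)" for \<phi>
    unfolding G_B_def
    by (intro arg_cong[where f = "(\<odot>) \<i>"] sum.cong refl)
       (simp add: fun_eq_iff K_def B_def Bc_def algebra_simps)
  have "\<i> \<odot> G_B ks \<theta> \<phi> = (\<Sum>k\<in>set ks. complex_of_real (\<theta> k) \<odot> K k \<phi>)"
    "(- \<i>) \<odot> G_B ks \<theta> \<phi> = (\<Sum>k\<in>set ks. complex_of_real (- \<theta> k) \<odot> K k \<phi>)" for \<phi>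
    unfolding G by (auto simp: fun_eq_iff sum_fun_apply sum_negf)
  then show "op_exp (\<lambda>\<phi>. \<i> \<odot> G_B ks \<theta> \<phi>) \<psi> = V \<theta> \<psi>"
    "op_exp (\<lambda>\<phi>. (- \<i>) \<odot> G_B ks \<theta> \<phi>) \<psi> = V (\<lambda>k. - \<theta> k) \<psi>"
    using exp_V[of \<theta>] exp_V[of "\<lambda>k. - \<theta> k"] by simp_all
qed

lemma rot_K_commute:
  "j \<in> set ks \<Longrightarrow> k \<in> set ks \<Longrightarrow> rot s (K j) (rot t (K k) \<psi>) = rot t (K k) (rot s (K j) \<psi>)"
  by (intro rot_commute_op lin_rot lin_K rot_commute_op[symmetric] K_commute)

text \<open>The inverse factors stand in the same list order, not in the reversed one. Since the
  rotations commute, each can be moved next to its inverse.\<close>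

lemma V_minus_V: "V (\<lambda>k. - \<theta> k) (V \<theta> \<psi>) = \<psi>"
proof -
  have "foldr (\<lambda>k. rot (- \<theta> k) (K k)) xs (foldr (\<lambda>k. rot (\<theta> k) (K k)) xs \<psi>) = \<psi>"
    if "set xs \<subseteq> set ks" for xs \<psi>
    using that
  proof (induction xs arbitrary: \<psi>)
    case (Cons k xs)
    have "foldr (\<lambda>k. rot (- \<theta> k) (K k)) xs (rot (\<theta> k) (K k) \<phi>)
        = rot (\<theta> k) (K k) (foldr (\<lambda>k. rot (- \<theta> k) (K k)) xs \<phi>)" for \<phi>
      using Cons.prems by (intro foldr_commute_op[symmetric] rot_K_commute) auto
    then show ?case
      using Cons by (simp add: rot_minus_rot[OF lin_K K_cube])
  qed simp
  then show ?thesis by (simp add: V_def)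
qed

text \<open>Taking adjoints reverses the product; commutativity restores the list order.\<close>

lemma ip_V_left: "ip ks (V \<theta> \<phi>) \<psi> = ip ks \<phi> (V (\<lambda>k. - \<theta> k) \<psi>)"
proof -
  have "ip ks (foldr (\<lambda>k. rot (\<theta> k) (K k)) xs \<phi>) \<psi>
      = ip ks \<phi> (foldr (\<lambda>k. rot (- \<theta> k) (K k)) xs \<psi>)"
    if "set xs \<subseteq> set ks" for xs \<phi> \<psi>
    using that
  proof (induction xs arbitrary: \<phi> \<psi>)
    case (Cons k xs)
    have "foldr (\<lambda>k. rot (- \<theta> k) (K k)) xs (rot (- \<theta> k) (K k) \<psi>)
        = rot (- \<theta> k) (K k) (foldr (\<lambda>k. rot (- \<theta> k) (K k)) xs \<psi>)"
      using Cons.prems by (intro foldr_commute_op[symmetric] rot_K_commute) auto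
    then show ?case
      using Cons by (simp add: ip_rot[OF ip_K_left])
  qed simp
  then show ?thesis by (simp add: V_def)
qed

lemma ip_V_V: "ip ks (V \<theta> \<phi>) (V \<theta> \<psi>) = ip ks \<phi> \<psi>"
  by (simp add: ip_V_left V_minus_V)

end

section \<open>The pair sector and the Bogoliubov transformation\<close>

lemma sum_closed_pred:
  assumes "\<And>x. x \<in> A \<Longrightarrow> P (F x)" "P 0" "\<And>x y. P x \<Longrightarrow> P y \<Longrightarrow> P (x + y)"
  shows "P (sum F A)"
  using assms(1) by (induction A rule: infinite_finite_induct) (simp_all add: assms(2,3))

lemma ip_ket_left: "m \<in> configs ks \<Longrightarrow> ip ks (ket m) \<psi> = \<psi> m"
proof -
  assume "m \<in> configs ks"
  moreover have "ip ks (ket m) \<psi> = (\<Sum>n\<in>configs ks. if n = m then \<psi> n else 0)"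
    unfolding ip_def ket_def by (intro sum.cong) auto
  ultimately show ?thesis by simp
qed

text \<open>On this subspace each pair is either full or empty, so it behaves like a spin one half:
  the two projections add up to the identity (\<open>paired_B_Bc\<close>) and \<open>K k\<close>
  squares to -1.\<close>

definition paired :: "(real^3) list \<Rightarrow> state \<Rightarrow> bool" where
  "paired ks \<psi> \<longleftrightarrow>
    (\<forall>m. \<psi> m \<noteq> 0 \<longrightarrow> m \<in> configs ks \<and> (\<forall>k. (k, Up) \<in> m \<longleftrightarrow> (-k, Dn) \<in> m))"

lemma paired_zero: "paired ks 0"
  and paired_add: "paired ks \<phi> \<Longrightarrow> paired ks \<psi> \<Longrightarrow> paired ks (\<phi> + \<psi>)"
  and paired_diff: "paired ks \<phi> \<Longrightarrow> paired ks \<psi> \<Longrightarrow> paired ks (\<phi> - \<psi>)"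
  and paired_smul: "paired ks \<psi> \<Longrightarrow> paired ks (a \<odot> \<psi>)"
  and paired_vac: "paired ks vac"
  unfolding paired_def by (auto simp: vac_def ket_def) (metis add_0)+

lemma paired_sum: "(\<And>x. x \<in> A \<Longrightarrow> paired ks (F x)) \<Longrightarrow> paired ks (\<Sum>x\<in>A. F x)"
  by (rule sum_closed_pred[where P = "paired ks"]) (auto intro: paired_zero paired_add)

lemmas paired_rules = paired_zero paired_add paired_diff paired_smul paired_vac paired_sum

text \<open>For states of pairs, the class of \<open>card m\<close> modulo 4 is the parity of the number of pairs.\<close>

definition card_class :: "nat \<Rightarrow> state \<Rightarrow> bool" where
  "card_class r \<psi> \<longleftrightarrow> (\<forall>m. \<psi> m \<noteq> 0 \<longrightarrow> card m mod 4 = r)"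

lemma card_class_add: "card_class r \<phi> \<Longrightarrow> card_class r \<psi> \<Longrightarrow> card_class r (\<phi> + \<psi>)"
  and card_class_diff: "card_class r \<phi> \<Longrightarrow> card_class r \<psi> \<Longrightarrow> card_class r (\<phi> - \<psi>)"
  and card_class_smul: "card_class r \<psi> \<Longrightarrow> card_class r (a \<odot> \<psi>)"
  and card_class_zero: "card_class r 0"
  and card_class_vac: "card_class 0 vac"
  unfolding card_class_def by (auto simp: vac_def ket_def) (metis add_0)+

lemma card_class_sum: "(\<And>x. x \<in> A \<Longrightarrow> card_class r (F x)) \<Longrightarrow> card_class r (\<Sum>x\<in>A. F x)"
  by (rule sum_closed_pred[where P = "card_class r"]) (auto intro: card_class_zero card_class_add)

lemmas card_class_rules = card_class_zero card_class_add card_class_diff card_class_smul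
  card_class_vac card_class_sum

lemma ip_card_class: "card_class r \<phi> \<Longrightarrow> card_class s \<psi> \<Longrightarrow> r \<noteq> s \<Longrightarrow> ip ks \<phi> \<psi> = 0"
  unfolding ip_def card_class_def by (intro sum.neutral) (metis complex_cnj_zero mult_eq_0_iff)

context fermi_modes
begin

context
  fixes k assumes k: "k \<in> set ks"
begin

lemma paired_B: "paired ks \<psi> \<Longrightarrow> paired ks (B k \<psi>)"
  unfolding paired_def
proof (intro allI impI)
  fix m
  assume \<psi>: "\<forall>m. \<psi> m \<noteq> 0 \<longrightarrow> m \<in> configs ks \<and> (\<forall>k. (k, Up) \<in> m \<longleftrightarrow> (-k, Dn) \<in> m)"
    and "B k \<psi> m \<noteq> 0"
  then have m: "m \<in> configs ks" "(k, Up) \<notin> m" "(-k, Dn) \<notin> m"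
    and "\<psi> (insert (k, Up) (insert (-k, Dn) m)) \<noteq> 0"
    by (auto simp: B_apply[OF k] split: if_splits)
  with \<psi> have "\<forall>j. (j, Up) \<in> insert (k, Up) (insert (-k, Dn) m)
      \<longleftrightarrow> (-j, Dn) \<in> insert (k, Up) (insert (-k, Dn) m)"
    by blast
  with m show "m \<in> configs ks \<and> (\<forall>j. (j, Up) \<in> m \<longleftrightarrow> (-j, Dn) \<in> m)"
    by auto
qed

lemma paired_Bc: "paired ks \<psi> \<Longrightarrow> paired ks (Bc k \<psi>)"
  unfolding paired_def
proof (intro allI impI)
  fix m
  assume \<psi>: "\<forall>m. \<psi> m \<noteq> 0 \<longrightarrow> m \<in> configs ks \<and> (\<forall>k. (k, Up) \<in> m \<longleftrightarrow> (-k, Dn) \<in> m)"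
    and "Bc k \<psi> m \<noteq> 0"
  then have m: "m \<in> configs ks" "(k, Up) \<in> m" "(-k, Dn) \<in> m"
    and "\<psi> (m - {(k, Up), (-k, Dn)}) \<noteq> 0"
    by (auto simp: Bc_apply[OF k] split: if_splits)
  with \<psi> have "\<forall>j. (j, Up) \<in> m - {(k, Up), (-k, Dn)} \<longleftrightarrow> (-j, Dn) \<in> m - {(k, Up), (-k, Dn)}"
    by blast
  with m show "m \<in> configs ks \<and> (\<forall>j. (j, Up) \<in> m \<longleftrightarrow> (-j, Dn) \<in> m)"
    by auto
qed

lemma paired_B_Bc: "paired ks \<psi> \<Longrightarrow> B k (Bc k \<psi>) = \<psi> - Bc k (B k \<psi>)"
  by (rule ext) (auto simp: B_Bc_apply[OF k] Bc_B_apply[OF k] paired_def)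

text \<open>In a paired state a mode is occupied exactly when its partner is, so counting one mode
  counts the pair.\<close>

lemma paired_number:
  assumes "paired ks \<psi>"
  shows "creat ks (k, Up) (annih ks (k, Up) \<psi>) = Bc k (B k \<psi>)"
    and "creat ks (-k, Dn) (annih ks (-k, Dn) \<psi>) = Bc k (B k \<psi>)"
  using assms
  by (auto simp: fun_eq_iff creat_annih_self_apply Bc_B_apply[OF k] k uminus_ks paired_def)

text \<open>With \<open>K k\<close> squaring to -1, Rodrigues' formula becomes an ordinary plane
  rotation.\<close>

lemma paired_rot:
  assumes "paired ks \<psi>"
  shows "rot t (K k) \<psi> = complex_of_real (cos t) \<odot> \<psi> + complex_of_real (sin t) \<odot> K k \<psi>"
  unfolding rot_def K_K[OF k] paired_B_Bc[OF assms] by (rule ext) (simp add: algebra_simps)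

lemma paired_rot_closed: "paired ks \<psi> \<Longrightarrow> paired ks (rot t (K k) \<psi>)"
  unfolding rot_def K_def by (intro paired_rules paired_B paired_Bc)

text \<open>Removing two particles is modulo 4 the same as adding two, so \<open>B k\<close> and
  \<open>Bc k\<close> shift the class alike.\<close>

lemma card_class_B:
  assumes "card_class r \<psi>"
  shows "card_class ((r + 2) mod 4) (B k \<psi>)"
  unfolding card_class_def
proof (intro allI impI)
  fix m assume "B k \<psi> m \<noteq> 0"
  then have m: "m \<in> configs ks" "(k, Up) \<notin> m" "(-k, Dn) \<notin> m"
    and "\<psi> (insert (k, Up) (insert (-k, Dn) m)) \<noteq> 0"
    by (auto simp: B_apply[OF k] split: if_splits)
  then have "card (insert (k, Up) (insert (-k, Dn) m)) mod 4 = r"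
    using assms unfolding card_class_def by blast
  moreover have "card (insert (k, Up) (insert (-k, Dn) m)) = card m + 2"
    using m by (simp add: config_finite)
  moreover have "(c + 2) mod 4 = r \<Longrightarrow> c mod 4 = (r + 2) mod 4" for c :: nat
    by (drule sym) (simp add: mod_simps)
  ultimately show "card m mod 4 = (r + 2) mod 4"
    by metis
qed

lemma card_class_Bc:
  assumes "card_class r \<psi>"
  shows "card_class ((r + 2) mod 4) (Bc k \<psi>)"
  unfolding card_class_def
proof (intro allI impI)
  fix m assume "Bc k \<psi> m \<noteq> 0"
  then have m: "m \<in> configs ks" "(k, Up) \<in> m" "(-k, Dn) \<in> m"
    and "\<psi> (m - {(k, Up), (-k, Dn)}) \<noteq> 0"
    by (auto simp: Bc_apply[OF k] split: if_splits)
  then have "card (m - {(k, Up), (-k, Dn)}) mod 4 = r"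
    using assms unfolding card_class_def by blast
  moreover have "card m = card (m - {(k, Up), (-k, Dn)}) + 2"
    using m card_Diff_subset[of "{(k, Up), (-k, Dn)}" m] card_mono[of m "{(k, Up), (-k, Dn)}"]
    by (simp add: config_finite)
  ultimately show "card m mod 4 = (r + 2) mod 4"
    by (metis mod_add_left_eq)
qed

end

text \<open>On paired states, this is \<open>B k\<close> conjugated by the rotation through \<open>t\<close>.\<close>

definition B_rot :: "real \<Rightarrow> real^3 \<Rightarrow> state \<Rightarrow> state" where
  "B_rot t k \<psi> = complex_of_real (cos t * sin t) \<odot> (\<psi> - 2 \<odot> Bc k (B k \<psi>))
    + complex_of_real ((cos t)\<^sup>2) \<odot> B k \<psi> - complex_of_real ((sin t)\<^sup>2) \<odot> Bc k \<psi>"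

text \<open>Both sides are combinations of \<open>\<psi>\<close>, \<open>B k \<psi>\<close>,
  \<open>Bc k \<psi>\<close> and \<open>Bc k (B k \<psi>)\<close>. The intertwining form avoids
  applying the inverse rotation.\<close>

lemma B_rot_same:
  assumes "k \<in> set ks" "paired ks \<psi>"
  shows "B k (rot t (K k) \<psi>) = rot t (K k) (B_rot t k \<psi>)"
proof
  fix m
  define c s where "c = complex_of_real (cos t)" and "s = complex_of_real (sin t)"
  define n where "n = Bc k (B k \<psi>)"
  \<comment> \<open>The comparison of coefficients, with \<open>p\<close>, \<open>b\<close>,
    \<open>d\<close>, \<open>n\<close> standing for the coordinates of these four vectors.\<close>
  have *: "c * b + s * (p - n) = c * (c * s * (p - 2 * n) + c\<^sup>2 * b - s\<^sup>2 * d)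
      + s * (c * s * d + c\<^sup>2 * n + c * s * b + s\<^sup>2 * (p - n))"
    if "c\<^sup>2 + s\<^sup>2 = 1" for b d n p :: complex
    using that by algebra
  have cs: "c\<^sup>2 + s\<^sup>2 = 1"
    unfolding c_def s_def by (metis of_real_1 of_real_add of_real_power sin_cos_squared_add2)
  have X: "B_rot t k \<psi> = (c * s) \<odot> (\<psi> - 2 \<odot> n) + c\<^sup>2 \<odot> B k \<psi> - s\<^sup>2 \<odot> Bc k \<psi>"
    by (simp add: B_rot_def c_def s_def n_def)
  have "paired ks (B_rot t k \<psi>)"
    unfolding B_rot_def using assms by (intro paired_rules paired_B paired_Bc)
  note R = paired_rot[OF assms(1) this, of t, folded c_def s_def]
  have "B k n = B k \<psi>" "Bc k n = 0" "B k (Bc k \<psi>) = \<psi> - n"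
    by (simp_all add: n_def assms(1) paired_B_Bc[OF assms])
  then have KX: "K k (B_rot t k \<psi>)
      = (c * s) \<odot> Bc k \<psi> + c\<^sup>2 \<odot> n + (c * s) \<odot> B k \<psi> + s\<^sup>2 \<odot> (\<psi> - n)"
    by (simp add: K_def X lin_B_rules assms(1) flip: n_def) (rule ext, simp add: algebra_simps)
  have "B k (rot t (K k) \<psi>) = c \<odot> B k \<psi> + s \<odot> (\<psi> - n)"
    unfolding paired_rot[OF assms]
    by (simp add: K_def lin_B_rules assms(1) paired_B_Bc[OF assms] c_def s_def n_def)
  then show "B k (rot t (K k) \<psi>) m = rot t (K k) (B_rot t k \<psi>) m"
    unfolding R KX unfolding X by (simp add: *[OF cs])
qed

lemma B_rot_other:
  assumes "j \<in> set ks" "k \<in> set ks" "j \<noteq> k"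
  shows "B_rot t j (rot s (K k) \<psi>) = rot s (K k) (B_rot t j \<psi>)"
  unfolding B_rot_def
  by (simp add: rot_commute_op[of "B j" "K k"] rot_commute_op[of "Bc j" "K k"]
      B_K_commute Bc_K_commute lin_B lin_Bc assms lin_rules[OF lin_rot[OF lin_K]])

lemma paired_V: "paired ks \<psi> \<Longrightarrow> paired ks (V \<theta> \<psi>)"
proof -
  have "set xs \<subseteq> set ks \<Longrightarrow> paired ks \<psi> \<Longrightarrow> paired ks (foldr (\<lambda>k. rot (\<theta> k) (K k)) xs \<psi>)" for xs
    by (induction xs) (auto intro: paired_rot_closed)
  then show "paired ks \<psi> \<Longrightarrow> paired ks (V \<theta> \<psi>)" by (simp add: V_def)
qed

text \<open>Only the rotation labelled \<open>k\<close> changes \<open>B k\<close>; the others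
  commute with it.\<close>

lemma B_V:
  assumes "k \<in> set ks" "paired ks \<psi>"
  shows "B k (V \<theta> \<psi>) = V \<theta> (B_rot (\<theta> k) k \<psi>)"
proof -
  let ?F = "foldr (\<lambda>k. rot (\<theta> k) (K k))"
  \<comment> \<open>The conditional records whether the rotation labelled \<open>k\<close> has been
    passed. Pairedness is carried along because \<open>B_rot_same\<close> needs it.\<close>
  have "B k (?F xs \<psi>) = ?F xs (if k \<in> set xs then B_rot (\<theta> k) k \<psi> else B k \<psi>)
      \<and> paired ks (?F xs \<psi>)"
    if "set xs \<subseteq> set ks" "distinct xs" for xs
    using that
  proof (induction xs)
    case (Cons j xs)
    then have IH: "B k (?F xs \<psi>) = ?F xs (if k \<in> set xs then B_rot (\<theta> k) k \<psi> else B k \<psi>)"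
      and P: "paired ks (?F xs \<psi>)" and j: "j \<in> set ks" by auto
    have "B k (rot (\<theta> j) (K j) (?F xs \<psi>))
        = rot (\<theta> j) (K j) (?F xs (if k \<in> set (j # xs) then B_rot (\<theta> k) k \<psi> else B k \<psi>))"
    proof (cases "j = k")
      case True
      then have "B_rot (\<theta> k) k (?F xs \<psi>) = ?F xs (B_rot (\<theta> k) k \<psi>)"
        using Cons.prems assms(1) by (intro foldr_commute_op B_rot_other) auto
      then show ?thesis
        using B_rot_same[OF assms(1) P] True by simp
    next
      case False
      then have "B k (rot (\<theta> j) (K j) (?F xs \<psi>)) = rot (\<theta> j) (K j) (B k (?F xs \<psi>))"
        using assms(1) j by (intro rot_commute_op lin_B B_K_commute) auto
      then show ?thesis
        using False by (simp add: IH)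
    qed
    then show ?case
      using paired_rot_closed[OF j P] by simp
  qed (use assms in simp)
  from this[of ks] show ?thesis
    using assms(1) distinct_ks by (simp add: V_def)
qed

text \<open>For \<open>gam_adj_V\<close>: \<open>adj\<close> is 0 by definition at such labels, so
  the other side has to be controlled there too.\<close>

lemma V_outside: "m \<notin> configs ks \<Longrightarrow> V \<theta> \<psi> m = \<psi> m"
proof -
  assume m: "m \<notin> configs ks"
  then have K: "k \<in> set ks \<Longrightarrow> K k \<psi> m = 0" for k \<psi>
    by (simp add: K_def B_apply Bc_apply)
  have "set xs \<subseteq> set ks \<Longrightarrow> foldr (\<lambda>k. rot (\<theta> k) (K k)) xs \<psi> m = \<psi> m" for xs
    by (induction xs) (auto simp: rot_def K)
  then show ?thesis by (simp add: V_def)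
qed

text \<open>\<open>gam\<close> is \<open>annih\<close> conjugated by the unitary
  \<open>V \<theta>\<close>, so its adjoint is \<open>creat\<close> conjugated in the same
  way.\<close>

lemma gam_adj_V:
  assumes "x \<in> set (modes ks)"
  shows "gam_adj ks \<theta> x (V \<theta> \<psi>) = V \<theta> (creat ks x \<psi>)"
proof
  fix m
  show "gam_adj ks \<theta> x (V \<theta> \<psi>) m = V \<theta> (creat ks x \<psi>) m"
  proof (cases "m \<in> configs ks")
    case True
    have "gam_adj ks \<theta> x (V \<theta> \<psi>) m
        = ip ks (V \<theta> (annih ks x (V (\<lambda>k. - \<theta> k) (ket m)))) (V \<theta> \<psi>)"
      using True by (simp add: gam_adj_def adj_def gam_def op_exp_G_B)
    also have "\<dots> = ip ks (ket m) (V \<theta> (creat ks x \<psi>))"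
      by (simp add: ip_V_V ip_annih_left[OF assms] ip_V_left V_minus_V)
    finally show ?thesis by (simp add: ip_ket_left[OF True])
  next
    case False
    then show ?thesis
      by (simp add: gam_adj_def adj_def V_outside creat_apply[OF assms])
  qed
qed

lemma Psi_BCS_eq: "Psi_BCS ks \<theta> = V \<theta> vac"
  by (simp add: Psi_BCS_def op_exp_G_B)

text \<open>For symmetric \<open>a\<close> every unordered choice of two pairs is summed twice,
  which the factor 1/2 compensates.\<close>

definition two_pairs :: "(real^3 \<Rightarrow> real^3 \<Rightarrow> real) \<Rightarrow> state" where
  "two_pairs a = (1/2) \<odot> (\<Sum>p\<in>set ks. \<Sum>q\<in>set ks. complex_of_real (a p q) \<odot> Bc p (Bc q vac))"

lemma Phi_eq:
  "Phi ks \<xi> U \<Delta> \<theta> = V \<theta> (two_pairs (\<lambda>p q. U p q * mix \<theta> p q / (En \<xi> \<Delta> p + En \<xi> \<Delta> q)))"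
proof -
  have "gam_adj ks \<theta> (p, Up) (gam_adj ks \<theta> (-p, Dn) (gam_adj ks \<theta> (q, Up) (gam_adj ks \<theta> (-q, Dn)
      (Psi_BCS ks \<theta>)))) = V \<theta> (Bc p (Bc q vac))" if "p \<in> set ks" "q \<in> set ks" for p q
    using that by (simp add: Psi_BCS_eq gam_adj_V uminus_ks Bc_def)
  then show ?thesis
    unfolding Phi_def two_pairs_def by (simp add: lin_rules[OF lin_V] cong: sum.cong)
qed

text \<open>Both modes of a pair have the same kinetic energy, which gives the factor 2, and the
  interaction is a product of a pair creator and a pair annihilator.\<close>

lemma energy_paired:
  assumes "\<And>k. k \<in> set ks \<Longrightarrow> \<xi> (-k) = \<xi> k" "paired ks \<psi>"
  shows "energy ks \<xi> U \<psi> = (\<Sum>k\<in>set ks. complex_of_real (2 * \<xi> k) * ip ks (B k \<psi>) (B k \<psi>))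
    + (\<Sum>k\<in>set ks. \<Sum>k'\<in>set ks. complex_of_real (U k k') * ip ks (B k' \<psi>) (B k \<psi>))"
proof -
  let ?N = "\<lambda>x. ip ks \<psi> (creat ks x (annih ks x \<psi>))"
  have number_dn: "creat ks (k, Dn) (annih ks (k, Dn) \<psi>) = Bc (-k) (B (-k) \<psi>)"
    if "k \<in> set ks" for k
    using paired_number(2)[OF uminus_ks[OF that] assms(2)] by simp
  \<comment> \<open>The down mode at \<open>k\<close> belongs to the pair labelled
    \<open>-k\<close>, hence the reindexing and the use of the evenness of
    \<open>\<xi>\<close>.\<close>
  have dn: "(\<Sum>k\<in>set ks. complex_of_real (\<xi> k) * ?N (k, Dn))
      = (\<Sum>k\<in>set ks. complex_of_real (\<xi> k) * ip ks (B k \<psi>) (B k \<psi>))"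
    by (rule sum.reindex_bij_witness[of _ uminus uminus])
       (auto simp: uminus_ks assms(1) number_dn ip_B_left)
  have "energy ks \<xi> U \<psi> = (\<Sum>k\<in>set ks. complex_of_real (\<xi> k) * ?N (k, Up))
      + (\<Sum>k\<in>set ks. complex_of_real (\<xi> k) * ?N (k, Dn))
      + (\<Sum>k\<in>set ks. \<Sum>k'\<in>set ks. complex_of_real (U k k') * ip ks \<psi> (Bc k' (B k \<psi>)))"
    unfolding energy_def Ham_def
    by (simp add: ip_rules ip_sum_right sum.distrib B_def Bc_def)
  then show ?thesis
    unfolding dn
    by (simp add: paired_number[OF _ assms(2)] ip_B_left sum.distrib[symmetric] algebra_simps)
qed

lemma energy_V:
  assumes "\<And>k. k \<in> set ks \<Longrightarrow> \<xi> (-k) = \<xi> k" "paired ks \<psi>"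
  shows "energy ks \<xi> U (V \<theta> \<psi>)
    = (\<Sum>k\<in>set ks. complex_of_real (2 * \<xi> k) * ip ks (B_rot (\<theta> k) k \<psi>) (B_rot (\<theta> k) k \<psi>))
    + (\<Sum>k\<in>set ks. \<Sum>k'\<in>set ks. complex_of_real (U k k')
        * ip ks (B_rot (\<theta> k') k' \<psi>) (B_rot (\<theta> k) k \<psi>))"
  by (simp add: energy_paired[of \<xi> "V \<theta> \<psi>"] assms paired_V B_V ip_V_V)

text \<open>The cross terms between \<open>\<psi> - 2 \<odot> Bc k (B k \<psi>)\<close> and the two
  pair operators vanish by parity; those between \<open>B k \<psi>\<close> and
  \<open>Bc k \<psi>\<close> vanish because a pair cannot be removed or created twice.\<close>

lemma ip_B_rot_same:
  assumes "k \<in> set ks" "paired ks \<psi>" "card_class 0 \<psi>"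
  shows "ip ks (B_rot t k \<psi>) (B_rot t k \<psi>) = of_real ((sin t)\<^sup>2) * ip ks \<psi> \<psi>
    + of_real ((cos t)\<^sup>2 - (sin t)\<^sup>2) * ip ks (B k \<psi>) (B k \<psi>)"
proof -
  have odd: "card_class 2 (B k \<psi>)" "card_class 2 (Bc k \<psi>)"
    using card_class_B[OF assms(1,3)] card_class_Bc[OF assms(1,3)] by (simp_all add: numeral_2_eq_2)
  have even: "card_class 0 (\<psi> - 2 \<odot> Bc k (B k \<psi>))"
    using card_class_Bc[OF assms(1) odd(1)] by (intro card_class_rules assms(3)) simp
  note zero = ip_card_class[OF even odd(1)] ip_card_class[OF even odd(2)]
    ip_card_class[OF odd(1) even] ip_card_class[OF odd(2) even]
  define n where "n = ip ks (B k \<psi>) (B k \<psi>)"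
  have Bc_Bc_ip: "ip ks (Bc k \<psi>) (Bc k \<psi>) = ip ks \<psi> \<psi> - n"
    by (simp add: ip_Bc_left assms(1) paired_B_Bc[OF assms(1,2)] ip_rules n_def ip_B_left)
  have B_Bc_ip: "ip ks (B k \<psi>) (Bc k \<psi>) = 0" "ip ks (Bc k \<psi>) (B k \<psi>) = 0"
    by (simp_all add: ip_Bc_left ip_B_left assms(1) ip_rules)
  \<comment> \<open>One minus twice the pair number is a reflection, so it preserves the
    norm.\<close>
  have Z: "ip ks (\<psi> - 2 \<odot> Bc k (B k \<psi>)) (\<psi> - 2 \<odot> Bc k (B k \<psi>)) = ip ks \<psi> \<psi>"
    by (simp add: ip_rules ip_Bc_left ip_B_left[symmetric] assms(1))
  have c: "(complex_of_real (cos t))\<^sup>2 = 1 - (complex_of_real (sin t))\<^sup>2"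
    by (metis of_real_1 of_real_diff of_real_power cos_squared_eq)
  have "ip ks (B_rot t k \<psi>) (B_rot t k \<psi>) = of_real ((cos t * sin t)\<^sup>2) * ip ks \<psi> \<psi>
      + of_real ((cos t)\<^sup>2 * (cos t)\<^sup>2) * n + of_real ((sin t)\<^sup>2 * (sin t)\<^sup>2) * (ip ks \<psi> \<psi> - n)"
    unfolding B_rot_def
    by (simp only: ip_add_left ip_add_right ip_diff_left[of _ "_ + _"] ip_diff_right[of _ _ "_ + _"]
        ip_smul_left ip_smul_right zero Z Bc_Bc_ip B_Bc_ip n_def[symmetric])
       (simp add: power2_eq_square algebra_simps)
  then show ?thesis
    unfolding n_def[symmetric] of_real_mult of_real_power of_real_diff power_mult_distrib c
    by (simp add: algebra_simps power2_eq_square)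
qed

end

section \<open>Energies of trial states\<close>

context fermi_modes
begin

text \<open>Parity again removes the terms changing the number of pairs by one. The first line of
  the result is the expectation of the product of two reflections \<open>1 - 2 n\<close>, the last
  two lines are double pair annihilation and creation.\<close>

lemma ip_B_rot_other:
  assumes "j \<in> set ks" "k \<in> set ks" "j \<noteq> k" "paired ks \<psi>" "card_class 0 \<psi>"
  shows "ip ks (B_rot s j \<psi>) (B_rot t k \<psi>)
    = of_real (cos s * sin s * (cos t * sin t)) * (ip ks \<psi> \<psi> - 2 * ip ks (B j \<psi>) (B j \<psi>)
        - 2 * ip ks (B k \<psi>) (B k \<psi>) + 4 * ip ks (B j (B k \<psi>)) (B j (B k \<psi>)))
    + of_real ((cos s)\<^sup>2 * (cos t)\<^sup>2) * ip ks (B j \<psi>) (B k \<psi>)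
    + of_real ((sin s)\<^sup>2 * (sin t)\<^sup>2) * ip ks (B k \<psi>) (B j \<psi>)
    - of_real ((cos s)\<^sup>2 * (sin t)\<^sup>2) * ip ks (B j (B k \<psi>)) \<psi>
    - of_real ((sin s)\<^sup>2 * (cos t)\<^sup>2) * ip ks \<psi> (B j (B k \<psi>))"
proof -
  have odd: "card_class 2 (B i \<psi>)" "card_class 2 (Bc i \<psi>)"
    and even: "card_class 0 (\<psi> - 2 \<odot> Bc i (B i \<psi>))" if "i \<in> {j, k}" for i
  proof -
    have i: "i \<in> set ks" using that assms by auto
    show odd: "card_class 2 (B i \<psi>)" "card_class 2 (Bc i \<psi>)"
      using card_class_B[OF i assms(5)] card_class_Bc[OF i assms(5)] by (simp_all add: numeral_2_eq_2)
    show "card_class 0 (\<psi> - 2 \<odot> Bc i (B i \<psi>))"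
      using card_class_Bc[OF i odd(1)] by (intro card_class_rules assms) simp
  qed
  have zero: "ip ks (\<psi> - 2 \<odot> Bc j (B j \<psi>)) (B k \<psi>) = 0"
    "ip ks (\<psi> - 2 \<odot> Bc j (B j \<psi>)) (Bc k \<psi>) = 0"
    "ip ks (B j \<psi>) (\<psi> - 2 \<odot> Bc k (B k \<psi>)) = 0"
    "ip ks (Bc j \<psi>) (\<psi> - 2 \<odot> Bc k (B k \<psi>)) = 0"
    using ip_card_class[OF even odd(1), of j k] ip_card_class[OF even odd(2), of j k]
      ip_card_class[OF odd(1) even, of j k] ip_card_class[OF odd(2) even, of j k] by simp_all
  have n: "ip ks (Bc j (B j \<psi>)) (Bc k (B k \<psi>)) = ip ks (B j (B k \<psi>)) (B j (B k \<psi>))"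
    using assms by (simp add: ip_Bc_left B_Bc_commute ip_B_left[of k, symmetric] B_commute[of k j])
  have Z: "ip ks (\<psi> - 2 \<odot> Bc j (B j \<psi>)) (\<psi> - 2 \<odot> Bc k (B k \<psi>)) = ip ks \<psi> \<psi>
      - 2 * ip ks (B j \<psi>) (B j \<psi>) - 2 * ip ks (B k \<psi>) (B k \<psi>)
      + 4 * ip ks (B j (B k \<psi>)) (B j (B k \<psi>))"
    using assms by (simp add: ip_rules n) (simp add: ip_Bc_left ip_B_left[symmetric] algebra_simps)
  have cross: "ip ks (Bc j \<psi>) (Bc k \<psi>) = ip ks (B k \<psi>) (B j \<psi>)"
    "ip ks (B j \<psi>) (Bc k \<psi>) = ip ks (B j (B k \<psi>)) \<psi>"
    "ip ks (Bc j \<psi>) (B k \<psi>) = ip ks \<psi> (B j (B k \<psi>))"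
    using assms by (simp_all add: ip_Bc_left B_Bc_commute ip_B_left[symmetric] B_commute[of k j])
  show ?thesis
    unfolding B_rot_def
    by (simp only: ip_add_left ip_add_right ip_diff_left[of _ "_ + _"]
        ip_diff_right[of _ _ "_ + _"] ip_smul_left ip_smul_right zero Z cross)
       (simp add: algebra_simps)
qed

section \<open>Vacuum, two-pair states and their trial energies\<close>

lemma B_vac: "k \<in> set ks \<Longrightarrow> B k vac = 0"
  by (rule ext) (auto simp: B_apply vac_def ket_def)

lemma B_Bc_vac: "j \<in> set ks \<Longrightarrow> k \<in> set ks \<Longrightarrow> B j (Bc k vac) = (if j = k then vac else 0)"
  by (auto simp: paired_B_Bc paired_vac B_vac lin_B_rules B_Bc_commute)

lemma B_Bc_Bc_vac:
  assumes "k \<in> set ks" "p \<in> set ks" "q \<in> set ks" "p \<noteq> q"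
  shows "B k (Bc p (Bc q vac)) = (if p = k then Bc q vac else 0) + (if q = k then Bc p vac else 0)"
  using assms
  by (auto simp: paired_B_Bc paired_vac paired_Bc B_vac lin_B_rules B_Bc_commute)

lemma ip_vac_vac: "ip ks vac vac = 1"
  by (simp add: vac_def ip_ket_left) (simp add: ket_def)

lemma paired_two_pairs: "paired ks (two_pairs a)"
  unfolding two_pairs_def by (intro paired_rules paired_Bc)

lemma card_class_two_pairs: "card_class 0 (two_pairs a)"
proof -
  have "card_class 0 (Bc p (Bc q vac))" if "p \<in> set ks" "q \<in> set ks" for p q
    using card_class_Bc[OF that(1) card_class_Bc[OF that(2) card_class_vac]] by simp
  then show ?thesis
    unfolding two_pairs_def by (intro card_class_rules)
qed

lemma ip_vac_two_pairs: "ip ks vac (two_pairs a) = 0" "ip ks (two_pairs a) vac = 0"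
proof -
  show "ip ks vac (two_pairs a) = 0"
    by (simp add: two_pairs_def ip_rules ip_sum_right ip_B_left[symmetric] B_vac)
  then show "ip ks (two_pairs a) vac = 0"
    by (metis ip_cnj complex_cnj_zero)
qed

context
  fixes a :: "real^3 \<Rightarrow> real^3 \<Rightarrow> real"
  assumes a_sym: "\<And>p q. p \<in> set ks \<Longrightarrow> q \<in> set ks \<Longrightarrow> a q p = a p q"
    and a_diag: "\<And>p. p \<in> set ks \<Longrightarrow> a p p = 0"
begin

text \<open>The pair \<open>k\<close> can be removed as the first or as the second factor; by
  symmetry both contributions agree, and together they cancel the factor 1/2.\<close>

lemma B_two_pairs:
  assumes k: "k \<in> set ks"
  shows "B k (two_pairs a) = (\<Sum>q\<in>set ks. complex_of_real (a k q) \<odot> Bc q vac)"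
proof -
  have "B k (two_pairs a) = (1/2) \<odot> (\<Sum>p\<in>set ks. \<Sum>q\<in>set ks.
      complex_of_real (a p q) \<odot> B k (Bc p (Bc q vac)))"
    by (simp add: two_pairs_def lin_B_rules)
  also have "\<dots> = (1/2) \<odot> (\<Sum>p\<in>set ks. \<Sum>q\<in>set ks.
      (if p = k then complex_of_real (a p q) \<odot> Bc q vac else 0)
      + (if q = k then complex_of_real (a p q) \<odot> Bc p vac else 0))"
    (is "_ = _ \<odot> (\<Sum>p\<in>_. \<Sum>q\<in>_. ?f p q + ?g p q)")
  proof (intro arg_cong[where f = "(\<odot>) (1/2)"] sum.cong refl)
    fix p q assume pq: "p \<in> set ks" "q \<in> set ks"
    show "complex_of_real (a p q) \<odot> B k (Bc p (Bc q vac)) = ?f p q + ?g p q"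
    proof (cases "p = q")
      case True
      with a_diag pq have "a p q = 0" by simp
      then show ?thesis by auto
    next
      case False
      show ?thesis
        unfolding B_Bc_Bc_vac[OF k pq False] by (auto simp: fun_eq_iff algebra_simps)
    qed
  qed
  also have "\<dots> = (1/2) \<odot> ((\<Sum>p\<in>set ks. \<Sum>q\<in>set ks. ?f p q) + (\<Sum>p\<in>set ks. \<Sum>q\<in>set ks. ?g p q))"
    by (simp add: sum.distrib)
  also have "(\<Sum>p\<in>set ks. \<Sum>q\<in>set ks. ?f p q) = (\<Sum>q\<in>set ks. complex_of_real (a k q) \<odot> Bc q vac)"
    by (subst sum.swap) (simp add: k)
  also have "(\<Sum>p\<in>set ks. \<Sum>q\<in>set ks. ?g p q) = (\<Sum>q\<in>set ks. complex_of_real (a k q) \<odot> Bc q vac)"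
    by (simp add: k a_sym)
  also have "(1/2) \<odot> (\<phi> + \<phi>) = \<phi>" for \<phi> :: state
    by (rule ext) simp
  finally show ?thesis .
qed

lemma B_B_two_pairs:
  "j \<in> set ks \<Longrightarrow> k \<in> set ks \<Longrightarrow> B j (B k (two_pairs a)) = complex_of_real (a k j) \<odot> vac"
  by (simp add: B_two_pairs lin_B_rules B_Bc_vac if_distrib[of "\<lambda>x. _ \<odot> x"] cong: if_cong)

lemma ip_B_two_pairs:
  assumes "j \<in> set ks" "k \<in> set ks"
  shows "ip ks (B j (two_pairs a)) (B k (two_pairs a)) = of_real (\<Sum>q\<in>set ks. a j q * a k q)"
proof -
  have "ip ks (Bc q vac) (B k (two_pairs a)) = of_real (a k q)" if "q \<in> set ks" for q
    using that assms by (simp add: ip_Bc_left B_B_two_pairs ip_rules ip_vac_vac)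
  then show ?thesis
    by (simp add: B_two_pairs[OF assms(1)] ip_sum_left ip_smul_left)
qed

text \<open>Separate amplitudes let one formula serve for \<open>Psi_BCS\<close>, with
  \<open>X = 1\<close> and \<open>Y = 0\<close>, and for \<open>Psi\<close>, with
  \<open>X = Y\<close>. The sum \<open>T j k\<close> is the overlap of the states left after
  removing the pairs \<open>j\<close> and \<open>k\<close>.\<close>

lemma energy_trial:
  fixes X Y :: real and \<theta> \<xi> :: "real^3 \<Rightarrow> real" and U :: "real^3 \<Rightarrow> real^3 \<Rightarrow> real"
  assumes xi_even: "\<And>k. k \<in> set ks \<Longrightarrow> \<xi> (-k) = \<xi> k"
    and U_diag: "\<And>k. k \<in> set ks \<Longrightarrow> U k k = 0"
    and norm: "of_real (X\<^sup>2) + of_real (Y\<^sup>2) * ip ks (two_pairs a) (two_pairs a) = 1"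
  defines "T \<equiv> \<lambda>j k. \<Sum>q\<in>set ks. a j q * a k q"
  shows "energy ks \<xi> U (V \<theta> (of_real X \<odot> vac + of_real Y \<odot> two_pairs a)) = of_real (
      (\<Sum>k\<in>set ks. 2 * \<xi> k * ((sin (\<theta> k))\<^sup>2 + ((cos (\<theta> k))\<^sup>2 - (sin (\<theta> k))\<^sup>2) * (Y\<^sup>2 * T k k)))
    + (\<Sum>k\<in>set ks. \<Sum>k'\<in>set ks. U k k' *
        (cos (\<theta> k) * sin (\<theta> k) * (cos (\<theta> k') * sin (\<theta> k'))
          * (1 - 2 * Y\<^sup>2 * T k k - 2 * Y\<^sup>2 * T k' k' + 4 * Y\<^sup>2 * (a k k')\<^sup>2)
        + ((cos (\<theta> k))\<^sup>2 * (cos (\<theta> k'))\<^sup>2 + (sin (\<theta> k))\<^sup>2 * (sin (\<theta> k'))\<^sup>2) * (Y\<^sup>2 * T k k')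
        - mix \<theta> k k' * (X * Y * a k k'))))"
proof -
  define \<psi> where "\<psi> = of_real X \<odot> vac + of_real Y \<odot> two_pairs a"
  have P: "paired ks \<psi>" and C: "card_class 0 \<psi>"
    unfolding \<psi>_def
    by (intro paired_rules paired_two_pairs, intro card_class_rules card_class_two_pairs)
  have one: "ip ks \<psi> \<psi> = 1"
    using norm by (simp add: \<psi>_def ip_rules ip_vac_vac ip_vac_two_pairs power2_eq_square mult.assoc)
  have B\<psi>: "B k \<psi> = of_real Y \<odot> B k (two_pairs a)" if "k \<in> set ks" for k
    using that by (simp add: \<psi>_def lin_B_rules B_vac)
  have n: "ip ks (B j \<psi>) (B k \<psi>) = of_real (Y\<^sup>2 * T j k)"
    if "j \<in> set ks" "k \<in> set ks" for j k
    using that by (simp add: B\<psi> ip_rules ip_B_two_pairs T_def power2_eq_square)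
  have BB\<psi>: "B j (B k \<psi>) = of_real (Y * a k j) \<odot> vac" if "j \<in> set ks" "k \<in> set ks" for j k
    using that by (simp add: B\<psi> lin_B_rules B_B_two_pairs)
  have c: "ip ks (B j (B k \<psi>)) (B j (B k \<psi>)) = of_real (Y\<^sup>2 * (a k j)\<^sup>2)"
    "ip ks (B j (B k \<psi>)) \<psi> = of_real (X * Y * a k j)"
    "ip ks \<psi> (B j (B k \<psi>)) = of_real (X * Y * a k j)"
    if "j \<in> set ks" "k \<in> set ks" for j k
    using that
    by (simp_all add: BB\<psi> ip_rules ip_vac_vac power2_eq_square)
       (simp_all add: \<psi>_def ip_rules ip_vac_vac ip_vac_two_pairs)
  have T_sym: "T j k = T k j" for j k
    by (simp add: T_def mult.commute)
  have diag: "complex_of_real (2 * \<xi> k) * ip ks (B_rot (\<theta> k) k \<psi>) (B_rot (\<theta> k) k \<psi>)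
      = of_real (2 * \<xi> k * ((sin (\<theta> k))\<^sup>2 + ((cos (\<theta> k))\<^sup>2 - (sin (\<theta> k))\<^sup>2) * (Y\<^sup>2 * T k k)))"
    if "k \<in> set ks" for k
    using that by (simp add: ip_B_rot_same[OF that P C] one n)
  have off: "complex_of_real (U k k') * ip ks (B_rot (\<theta> k') k' \<psi>) (B_rot (\<theta> k) k \<psi>)
      = of_real (U k k' *
        (cos (\<theta> k) * sin (\<theta> k) * (cos (\<theta> k') * sin (\<theta> k'))
          * (1 - 2 * Y\<^sup>2 * T k k - 2 * Y\<^sup>2 * T k' k' + 4 * Y\<^sup>2 * (a k k')\<^sup>2)
        + ((cos (\<theta> k))\<^sup>2 * (cos (\<theta> k'))\<^sup>2 + (sin (\<theta> k))\<^sup>2 * (sin (\<theta> k'))\<^sup>2) * (Y\<^sup>2 * T k k')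
        - mix \<theta> k k' * (X * Y * a k k')))"
    if "k \<in> set ks" "k' \<in> set ks" for k k'
  \<comment> \<open>\<open>ip_B_rot_other\<close> covers distinct labels only; the diagonal terms
    disappear because \<open>U k k = 0\<close>.\<close>
  proof (cases "k = k'")
    case True
    then show ?thesis using U_diag that by simp
  next
    case False
    have eq: "ip ks (B_rot (\<theta> k') k' \<psi>) (B_rot (\<theta> k) k \<psi>) = of_real (
        cos (\<theta> k') * sin (\<theta> k') * (cos (\<theta> k) * sin (\<theta> k))
          * (1 - 2 * (Y\<^sup>2 * T k' k') - 2 * (Y\<^sup>2 * T k k) + 4 * (Y\<^sup>2 * (a k k')\<^sup>2))
        + (cos (\<theta> k'))\<^sup>2 * (cos (\<theta> k))\<^sup>2 * (Y\<^sup>2 * T k' k)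
        + (sin (\<theta> k'))\<^sup>2 * (sin (\<theta> k))\<^sup>2 * (Y\<^sup>2 * T k k')
        - (cos (\<theta> k'))\<^sup>2 * (sin (\<theta> k))\<^sup>2 * (X * Y * a k k')
        - (sin (\<theta> k'))\<^sup>2 * (cos (\<theta> k))\<^sup>2 * (X * Y * a k k'))"
      unfolding ip_B_rot_other[OF that(2,1) False[symmetric] P C] one n[OF that(1,1)]
        n[OF that(2,2)] n[OF that] n[OF that(2,1)] c[OF that(2,1)]
      by simp
    show ?thesis
      unfolding eq of_real_mult[of "U k k'"] T_sym[of k' k] mix_def
      by (intro arg_cong2[where f = "(*)"] refl arg_cong[where f = of_real]) (simp add: algebra_simps)
  qed
  have "energy ks \<xi> U (V \<theta> \<psi>)
      = (\<Sum>k\<in>set ks. complex_of_real (2 * \<xi> k) * ip ks (B_rot (\<theta> k) k \<psi>) (B_rot (\<theta> k) k \<psi>))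
      + (\<Sum>k\<in>set ks. \<Sum>k'\<in>set ks. complex_of_real (U k k')
          * ip ks (B_rot (\<theta> k') k' \<psi>) (B_rot (\<theta> k) k \<psi>))"
    using xi_even P by (rule energy_V)
  also have "\<dots> = (\<Sum>k\<in>set ks. of_real (2 * \<xi> k
          * ((sin (\<theta> k))\<^sup>2 + ((cos (\<theta> k))\<^sup>2 - (sin (\<theta> k))\<^sup>2) * (Y\<^sup>2 * T k k))))
      + (\<Sum>k\<in>set ks. \<Sum>k'\<in>set ks. of_real (U k k' *
          (cos (\<theta> k) * sin (\<theta> k) * (cos (\<theta> k') * sin (\<theta> k'))
            * (1 - 2 * Y\<^sup>2 * T k k - 2 * Y\<^sup>2 * T k' k' + 4 * Y\<^sup>2 * (a k k')\<^sup>2)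
          + ((cos (\<theta> k))\<^sup>2 * (cos (\<theta> k'))\<^sup>2 + (sin (\<theta> k))\<^sup>2 * (sin (\<theta> k'))\<^sup>2) * (Y\<^sup>2 * T k k')
          - mix \<theta> k k' * (X * Y * a k k'))))"
    by (intro arg_cong2[where f = "(+)"] sum.cong refl diag off)
  finally show ?thesis
    unfolding \<psi>_def of_real_add of_real_sum .
qed

end

section \<open>States with prescribed pairs and the energy of the normal state\<close>

definition pair_state :: "(real^3) list \<Rightarrow> state" where
  "pair_state xs = foldr Bc xs vac"

lemma paired_pair_state: "set xs \<subseteq> set ks \<Longrightarrow> paired ks (pair_state xs)"
  by (induction xs) (auto simp: pair_state_def paired_vac intro: paired_Bc)

lemma B_pair_state_notin:
  "set xs \<subseteq> set ks \<Longrightarrow> k \<in> set ks \<Longrightarrow> k \<notin> set xs \<Longrightarrow> B k (pair_state xs) = 0"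
  by (induction xs) (auto simp: pair_state_def B_vac B_Bc_commute lin_B_rules)

text \<open>Pair operators with different labels commute, so no sign arises whatever the position of
  \<open>k\<close> in the list.\<close>

lemma B_pair_state_in:
  "set xs \<subseteq> set ks \<Longrightarrow> distinct xs \<Longrightarrow> k \<in> set xs \<Longrightarrow>
   B k (pair_state xs) = pair_state (remove1 k xs)"
proof (induction xs)
  case (Cons j xs)
  show ?case
  proof (cases "j = k")
    case True
    then show ?thesis
      using Cons.prems B_pair_state_notin[of xs k] paired_pair_state[of xs]
      by (simp add: pair_state_def paired_B_Bc lin_B_rules)
  next
    case False
    then show ?thesis
      using Cons by (simp add: pair_state_def B_Bc_commute subset_iff)
  qed
qed simp

lemma Bc_pair_state_in: "set xs \<subseteq> set ks \<Longrightarrow> k \<in> set xs \<Longrightarrow> Bc k (pair_state xs) = 0"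
proof (induction xs)
  case (Cons j xs)
  show ?case
  proof (cases "j = k")
    case True
    then show ?thesis using Cons.prems by (simp add: pair_state_def)
  next
    case False
    have IH: "Bc k (pair_state xs) = 0" by (rule Cons.IH) (use Cons.prems False in auto)
    have "Bc k (pair_state (j # xs)) = Bc j (Bc k (pair_state xs))"
      unfolding pair_state_def foldr.simps comp_apply
      using Cons.prems False by (intro Bc_commute) auto
    then show ?thesis unfolding IH lin_zero[OF lin_Bc] .
  qed
qed simp

lemma ip_pair_state:
  "set xs \<subseteq> set ks \<Longrightarrow> distinct xs \<Longrightarrow> ip ks (pair_state xs) (pair_state xs) = 1"
  by (induction xs)
     (simp_all add: ip_vac_vac pair_state_def ip_Bc_left paired_B_Bc
       paired_pair_state[unfolded pair_state_def] B_pair_state_notin[unfolded pair_state_def]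
       ip_rules lin_B_rules)

text \<open>The interaction has zero expectation: its diagonal is zero, a missing pair cannot be
  annihilated, and a pair cannot hop onto an occupied one.\<close>

lemma energy_pair_state:
  assumes xs: "set xs \<subseteq> set ks" "distinct xs"
    and xi_even: "\<And>k. k \<in> set ks \<Longrightarrow> \<xi> (-k) = \<xi> k"
    and U_diag: "\<And>k. k \<in> set ks \<Longrightarrow> U k k = 0"
  shows "energy ks \<xi> U (pair_state xs) = of_real (\<Sum>k\<in>set xs. 2 * \<xi> k)"
proof -
  have norm: "ip ks (B k (pair_state xs)) (B k (pair_state xs)) = (if k \<in> set xs then 1 else 0)"
    if "k \<in> set ks" for k
    using that xs ip_pair_state[of "remove1 k xs"] set_remove1_subset[of k xs]
    by (auto simp: B_pair_state_in B_pair_state_notin ip_rules)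
  have off: "complex_of_real (U k k') * ip ks (B k' (pair_state xs)) (B k (pair_state xs)) = 0"
    if "k \<in> set ks" "k' \<in> set ks" for k k'
  proof (cases "k = k' \<or> k \<notin> set xs \<or> k' \<notin> set xs")
    case True
    then show ?thesis using that xs U_diag by (auto simp: B_pair_state_notin ip_rules)
  next
    case False
    have Z: "Bc k' (pair_state xs) = 0"
      using False xs by (intro Bc_pair_state_in) auto
    have "ip ks (B k' (pair_state xs)) (B k (pair_state xs))
        = ip ks (pair_state xs) (B k (Bc k' (pair_state xs)))"
      using False that by (simp add: ip_B_left B_Bc_commute)
    then show ?thesis unfolding Z lin_zero[OF lin_B] ip_zero_right by simp
  qed
  have "energy ks \<xi> U (pair_state xs)
      = (\<Sum>k\<in>set ks. complex_of_real (2 * \<xi> k) * (if k \<in> set xs then 1 else 0))"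
    unfolding energy_paired[of \<xi>, OF xi_even paired_pair_state[OF xs(1)], simplified]
    by (simp add: norm off)
  also have "\<dots> = of_real (\<Sum>k\<in>set xs. 2 * \<xi> k)"
    unfolding of_real_sum using xs(1)
    by (intro sum.mono_neutral_cong_right) auto
  finally show ?thesis .
qed

end

section \<open>The energy balance\<close>

lemma uminus_Lam: "k \<in> Lam L Kmax \<Longrightarrow> - k \<in> Lam L Kmax"
proof -
  assume "k \<in> Lam L Kmax"
  then obtain n1 n2 n3 :: int where k: "k = (2 * pi / L) *\<^sub>R vector [of_int n1, of_int n2, of_int n3]"
    and le: "2 * pi / L * sqrt ((of_int n1)\<^sup>2 + (of_int n2)\<^sup>2 + (of_int n3)\<^sup>2) \<le> Kmax"
    by (auto simp: Lam_def)
  have "- k = (2 * pi / L) *\<^sub>R vector [of_int (- n1), of_int (- n2), of_int (- n3)]"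
    unfolding k by (simp add: vec_eq_iff forall_3)
  moreover have "2 * pi / L * sqrt ((of_int (- n1))\<^sup>2 + (of_int (- n2))\<^sup>2 + (of_int (- n3))\<^sup>2) \<le> Kmax"
    using le by simp
  ultimately show ?thesis
    unfolding Lam_def by blast
qed

lemma mix_nonneg: "mix \<theta> p q \<ge> 0"
  by (simp add: mix_def)

lemma mix_commute: "mix \<theta> p q = mix \<theta> q p"
  by (simp add: mix_def)

lemma sum_pair_quadratic:
  fixes a :: "'b \<Rightarrow> 'b \<Rightarrow> real"
  assumes "\<And>p q. p \<in> A \<Longrightarrow> q \<in> A \<Longrightarrow> a q p = a p q"
  shows "(\<Sum>p\<in>A. \<Sum>q\<in>A. (e p + e q) * (a p q)\<^sup>2) = (\<Sum>p\<in>A. 2 * e p * (\<Sum>q\<in>A. a p q * a p q))"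
proof -
  have "(\<Sum>p\<in>A. \<Sum>q\<in>A. e q * (a p q)\<^sup>2) = (\<Sum>p\<in>A. \<Sum>q\<in>A. e p * (a p q)\<^sup>2)"
    by (subst sum.swap) (intro sum.cong refl, simp add: assms)
  then have "(\<Sum>p\<in>A. \<Sum>q\<in>A. (e p + e q) * (a p q)\<^sup>2) = 2 * (\<Sum>p\<in>A. \<Sum>q\<in>A. e p * (a p q)\<^sup>2)"
    by (simp add: distrib_right sum.distrib)
  also have "\<dots> = (\<Sum>p\<in>A. 2 * e p * (\<Sum>q\<in>A. a p q * a p q))"
    by (simp only: sum_distrib_left power2_eq_square mult.assoc)
  finally show ?thesis .
qed

text \<open>The algebraic content of the gap equation: the terms of the trial energy that are quadratic in
  the amplitude of the excited pairs sum up to their excitation energies, which the interference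
  with the ground state cancels exactly.\<close>

lemma trial_energy_eq:
  fixes U a :: "'b \<Rightarrow> 'b \<Rightarrow> real" and \<xi> \<Delta> E \<theta> :: "'b \<Rightarrow> real" and y :: real
  assumes a_sym: "\<And>p q. p \<in> A \<Longrightarrow> q \<in> A \<Longrightarrow> a q p = a p q"
    and U_sym: "\<And>p q. p \<in> A \<Longrightarrow> q \<in> A \<Longrightarrow> U q p = U p q"
    and gap: "\<And>k. k \<in> A \<Longrightarrow> \<Delta> k = - (\<Sum>p\<in>A. U k p * (cos (\<theta> p) * sin (\<theta> p)))"
    and xi: "\<And>k. k \<in> A \<Longrightarrow> \<xi> k = E k * cos (2 * \<theta> k)"
    and Delta: "\<And>k. k \<in> A \<Longrightarrow> \<Delta> k = E k * sin (2 * \<theta> k)"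
    and m: "\<And>p q. p \<in> A \<Longrightarrow> q \<in> A \<Longrightarrow> U p q * mx p q = (E p + E q) * a p q"
  defines "T \<equiv> \<lambda>j k. \<Sum>q\<in>A. a j q * a k q"
  shows "(\<Sum>k\<in>A. 2 * \<xi> k * ((sin (\<theta> k))\<^sup>2 + ((cos (\<theta> k))\<^sup>2 - (sin (\<theta> k))\<^sup>2) * (y * T k k)))
    + (\<Sum>k\<in>A. \<Sum>k'\<in>A. U k k' *
        (cos (\<theta> k) * sin (\<theta> k) * (cos (\<theta> k') * sin (\<theta> k'))
          * (1 - 2 * y * T k k - 2 * y * T k' k' + 4 * y * (a k k')\<^sup>2)
        + ((cos (\<theta> k))\<^sup>2 * (cos (\<theta> k'))\<^sup>2 + (sin (\<theta> k))\<^sup>2 * (sin (\<theta> k'))\<^sup>2) * (y * T k k')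
        - mx k k' * (y * a k k')))
    = (\<Sum>k\<in>A. 2 * \<xi> k * (sin (\<theta> k))\<^sup>2)
    + (\<Sum>k\<in>A. \<Sum>k'\<in>A. U k k' * (cos (\<theta> k) * sin (\<theta> k) * (cos (\<theta> k') * sin (\<theta> k'))))
    + y * ((\<Sum>k\<in>A. \<Sum>k'\<in>A. U k k'
          * ((cos (\<theta> k))\<^sup>2 * (cos (\<theta> k'))\<^sup>2 + (sin (\<theta> k))\<^sup>2 * (sin (\<theta> k'))\<^sup>2) * T k k')
        + 4 * (\<Sum>k\<in>A. \<Sum>k'\<in>A. U k k' * (cos (\<theta> k) * sin (\<theta> k) * (cos (\<theta> k') * sin (\<theta> k')))
            * (a k k')\<^sup>2))"
proof -
  define d where "d k = cos (\<theta> k) * sin (\<theta> k)" for k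
  define h where "h k k' = (cos (\<theta> k))\<^sup>2 * (cos (\<theta> k'))\<^sup>2 + (sin (\<theta> k))\<^sup>2 * (sin (\<theta> k'))\<^sup>2" for k k'
  have gap_d: "(\<Sum>p\<in>A. U k p * d p) = - \<Delta> k" if "k \<in> A" for k
    using gap[OF that] by (simp add: d_def)
  have "(\<Sum>k\<in>A. \<Sum>k'\<in>A. U k k' * (d k * d k') * T k k) = (\<Sum>k\<in>A. d k * T k k * (\<Sum>k'\<in>A. U k k' * d k'))"
    by (simp add: sum_distrib_left mult_ac)
  also have "\<dots> = - (\<Sum>k\<in>A. d k * T k k * \<Delta> k)"
    by (simp add: gap_d sum_negf)
  \<comment> \<open>The inner sum over \<open>k'\<close> was evaluated by the gap equation.\<close>
  finally have n1: "(\<Sum>k\<in>A. \<Sum>k'\<in>A. U k k' * (d k * d k') * T k k) = - (\<Sum>k\<in>A. d k * T k k * \<Delta> k)" .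
  have n2: "(\<Sum>k\<in>A. \<Sum>k'\<in>A. U k k' * (d k * d k') * T k' k') = - (\<Sum>k\<in>A. d k * T k k * \<Delta> k)"
    unfolding n1[symmetric] by (subst sum.swap) (intro sum.cong refl, simp add: U_sym mult_ac)
  have "(\<Sum>k\<in>A. \<Sum>k'\<in>A. U k k' * (mx k k' * a k k')) = (\<Sum>k\<in>A. \<Sum>k'\<in>A. (E k + E k') * (a k k')\<^sup>2)"
    by (intro sum.cong refl) (simp add: m power2_eq_square flip: mult.assoc)
  also have "\<dots> = (\<Sum>k\<in>A. 2 * E k * T k k)"
    unfolding T_def by (rule sum_pair_quadratic) (rule a_sym)
  also have "\<dots> = (\<Sum>k\<in>A. 2 * \<xi> k * (((cos (\<theta> k))\<^sup>2 - (sin (\<theta> k))\<^sup>2) * T k k) + 4 * (d k * T k k * \<Delta> k))"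
  proof (intro sum.cong refl)
    fix k assume k: "k \<in> A"
    \<comment> \<open>In polar form, \<open>\<xi> k\<close> and \<open>\<Delta> k\<close> are the
      coordinates of a vector of length \<open>E k\<close> at angle twice \<open>\<theta> k\<close>;
      projecting it on its own direction recovers \<open>E k\<close>.\<close>
    have "\<xi> k = E k * ((cos (\<theta> k))\<^sup>2 - (sin (\<theta> k))\<^sup>2)" "\<Delta> k = E k * (2 * d k)"
      using xi[OF k] Delta[OF k] by (simp_all add: cos_double sin_double d_def)
    moreover have "(sin (\<theta> k))\<^sup>2 + (cos (\<theta> k))\<^sup>2 = 1" by simp
    ultimately show "2 * E k * T k k
        = 2 * \<xi> k * (((cos (\<theta> k))\<^sup>2 - (sin (\<theta> k))\<^sup>2) * T k k) + 4 * (d k * T k k * \<Delta> k)"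
      unfolding d_def by algebra
  qed
  finally have n3: "(\<Sum>k\<in>A. \<Sum>k'\<in>A. U k k' * (mx k k' * a k k'))
      = (\<Sum>k\<in>A. 2 * \<xi> k * (((cos (\<theta> k))\<^sup>2 - (sin (\<theta> k))\<^sup>2) * T k k)) + 4 * (\<Sum>k\<in>A. d k * T k k * \<Delta> k)"
    by (simp add: sum.distrib sum_distrib_left)
  \<comment> \<open>Collects the coefficient of \<open>y\<close>. In it, \<open>n3\<close> equals
    the kinetic part minus twice \<open>n1\<close> and twice \<open>n2\<close>, so these terms
    cancel.\<close>
  have split: "U k k' * (d k * d k' * (1 - 2 * y * T k k - 2 * y * T k' k' + 4 * y * (a k k')\<^sup>2)
        + h k k' * (y * T k k') - mx k k' * (y * a k k'))
      = U k k' * (d k * d k') + y * (U k k' * h k k' * T k k' + 4 * (U k k' * (d k * d k') * (a k k')\<^sup>2)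
        - 2 * (U k k' * (d k * d k') * T k k) - 2 * (U k k' * (d k * d k') * T k' k')
        - U k k' * (mx k k' * a k k'))" for k k'
    by (simp add: algebra_simps)
  show ?thesis
    unfolding d_def[symmetric] h_def[symmetric] split sum.distrib sum_subtractf sum_distrib_left[symmetric]
      n1 n2 n3
    by (simp add: algebra_simps sum.distrib sum_distrib_left sum_subtractf)
qed

lemma double_sum_neg:
  fixes f :: "'b \<Rightarrow> 'b \<Rightarrow> real"
  assumes "finite A" "\<And>i j. i \<in> A \<Longrightarrow> j \<in> A \<Longrightarrow> f i j \<le> 0" "i \<in> A" "j \<in> A" "f i j < 0"
  shows "(\<Sum>i\<in>A. \<Sum>j\<in>A. f i j) < 0"
proof -
  have "(\<Sum>j\<in>A. f i j) < (\<Sum>j\<in>A. 0)"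
    using assms by (intro sum_strict_mono_ex1) auto
  moreover have "(\<Sum>j\<in>A. f i' j) \<le> 0" if "i' \<in> A" for i'
    using assms(2) that by (intro sum_nonpos) auto
  ultimately have "(\<Sum>i\<in>A. \<Sum>j\<in>A. f i j) < (\<Sum>i\<in>A. 0)"
    using assms(1,3) by (intro sum_strict_mono_ex1) auto
  then show ?thesis by simp
qed

text \<open>With \<open>c = cos (2 t)\<close> the left side is \<open>- e (1 - c)^2 / 2\<close>.
  This is at most 0, and it is at most \<open>2 e c = 2 x\<close> because \<open>(1 + c)^2\<close>
  is nonnegative.\<close>

lemma ground_energy_le:
  fixes e x g :: real
  assumes "e = sqrt (x\<^sup>2 + g\<^sup>2)" "x = e * cos (2 * t)" "g = e * sin (2 * t)"
  shows "2 * x * (sin t)\<^sup>2 - cos t * sin t * g \<le> (if x \<le> 0 then 2 * x else 0)"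
proof -
  have e: "e \<ge> 0" by (simp add: assms(1))
  define c where "c = cos (2 * t)"
  have c: "\<bar>c\<bar> \<le> 1" by (simp add: c_def)
  have s: "sin (2 * t) * sin (2 * t) = 1 - c * c"
    using sin_cos_squared_add3[of "2 * t"] by (simp add: c_def algebra_simps)
  have sin2: "(sin t)\<^sup>2 = (1 - c) / 2"
    using cos_double_sin[of t] by (simp add: c_def)
  have "cos t * sin t * g = e * (sin (2 * t) * sin (2 * t)) / 2"
    using sin_double[of t] assms(3) by simp
  then have "cos t * sin t * g = e * (1 - c * c) / 2" by (simp add: s)
  moreover have "2 * x * (sin t)\<^sup>2 = e * (c - c * c)"
    unfolding sin2 assms(2)[folded c_def] by (simp add: field_simps)
  ultimately have L: "2 * x * (sin t)\<^sup>2 - cos t * sin t * g = e * (- (1 - c)\<^sup>2 / 2)"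
    by (simp add: power2_eq_square field_simps)
  show ?thesis
  proof (cases "x \<le> 0")
    case True
    have "e * (- (1 - c)\<^sup>2 / 2) \<le> e * (2 * c)"
      by (intro mult_left_mono e) (use zero_le_power2[of "1 + c"] in \<open>simp add: power2_eq_square algebra_simps\<close>)
    then show ?thesis unfolding L using True assms(2) c_def by simp
  next
    case False
    have "e * (- (1 - c)\<^sup>2 / 2) \<le> e * 0"
      by (intro mult_left_mono e) simp
    then show ?thesis unfolding L using False by simp
  qed
qed

theorem theorem5p5:
  fixes L Kmax hbar m \<mu> :: real
    and ks :: "(real^3) list"
    and U :: "real^3 \<Rightarrow> real^3 \<Rightarrow> real"
    and \<xi> \<Delta> \<theta> :: "real^3 \<Rightarrow> real"
  assumes pos: "L > 0" "Kmax > 0" "hbar > 0" "m > 0" "\<mu> > 0"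
    and order: "set ks = Lam L Kmax" "distinct ks"
    and xi: "\<xi> = xi hbar m \<mu>"
    and U_nonpos: "\<And>k k'. k \<in> Lam L Kmax \<Longrightarrow> k' \<in> Lam L Kmax \<Longrightarrow> U k k' \<le> 0"
    and U_sym: "\<And>k k'. k \<in> Lam L Kmax \<Longrightarrow> k' \<in> Lam L Kmax \<Longrightarrow> U k' k = U k k'"
    and U_neg: "\<And>k k'. k \<in> Lam L Kmax \<Longrightarrow> k' \<in> Lam L Kmax \<Longrightarrow> U (-k) (-k') = U k k'"
    and U_diag: "\<And>k. k \<in> Lam L Kmax \<Longrightarrow> U k k = 0"
    and Delta_nonneg: "\<And>k. k \<in> Lam L Kmax \<Longrightarrow> \<Delta> k \<ge> 0"
    and Delta_even: "\<And>k. k \<in> Lam L Kmax \<Longrightarrow> \<Delta> (-k) = \<Delta> k"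
    and gap: "\<And>k. k \<in> Lam L Kmax \<Longrightarrow>
        \<Delta> k = - (1/2) * (\<Sum>k'\<in>Lam L Kmax. U k k' * \<Delta> k' / sqrt ((\<xi> k')\<^sup>2 + (\<Delta> k')\<^sup>2))"
    and theta_range: "\<And>k. k \<in> Lam L Kmax \<Longrightarrow> 0 \<le> \<theta> k \<and> \<theta> k \<le> pi / 2"
    and theta_normal: "\<And>k. k \<in> Lam L Kmax \<Longrightarrow> (\<forall>q\<in>Lam L Kmax. \<Delta> q = 0) \<Longrightarrow> \<xi> k = 0 \<Longrightarrow>
        \<theta> k = pi / 2"
    and theta: "\<And>k. k \<in> Lam L Kmax \<Longrightarrow> \<not> ((\<forall>q\<in>Lam L Kmax. \<Delta> q = 0) \<and> \<xi> k = 0) \<Longrightarrow>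
        sqrt ((\<xi> k)\<^sup>2 + (\<Delta> k)\<^sup>2) \<noteq> 0 \<and>
        sin (2 * \<theta> k) = \<Delta> k / sqrt ((\<xi> k)\<^sup>2 + (\<Delta> k)\<^sup>2) \<and>
        cos (2 * \<theta> k) = \<xi> k / sqrt ((\<xi> k)\<^sup>2 + (\<Delta> k)\<^sup>2)"
  shows "energy ks \<xi> U (Psi ks \<xi> U \<Delta> \<theta>) - energy ks \<xi> U (Psi_BCS ks \<theta>)
           = complex_of_real (DeltaE ks \<xi> U \<Delta> \<theta>) \<and>
         (coupled ks \<xi> U \<Delta> \<longrightarrow>
           DeltaE ks \<xi> U \<Delta> \<theta> < 0 \<and>
           energy ks \<xi> U (Psi ks \<xi> U \<Delta> \<theta>) < energy ks \<xi> U (Psi_BCS ks \<theta>) \<and>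
           energy ks \<xi> U (Psi ks \<xi> U \<Delta> \<theta>) < energy ks \<xi> U (Psi_F ks \<xi>))"
proof -
  have m': "U p q * mix \<theta> p q = (En \<xi> \<Delta> p + En \<xi> \<Delta> q) * (U p q * mix \<theta> p q / (En \<xi> \<Delta> p + En \<xi> \<Delta> q))"
    if "p \<in> set ks" "q \<in> set ks" for p q
  \<comment> \<open>If the denominator is 0, the quotient is 0 by convention; the equation survives
    because both angles are then \<open>pi / 2\<close> and \<open>mix\<close> vanishes.\<close>
  proof (cases "En \<xi> \<Delta> p + En \<xi> \<Delta> q = 0")
    case True
    then have "En \<xi> \<Delta> p = 0" "En \<xi> \<Delta> q = 0"
      by (simp_all add: En_def add_nonneg_eq_0_iff)
    then have "\<theta> p = pi / 2" "\<theta> q = pi / 2"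
      using theta[of p] theta[of q] theta_normal[of p] theta_normal[of q] that order(1)
      by (auto simp: En_def)
    then have "cos (\<theta> p) = 0" "cos (\<theta> q) = 0" by (simp_all only: cos_pi_half)
    then show ?thesis by (simp add: mix_def)
  qed simp
  interpret fermi_modes ks
    by standard (use order uminus_Lam in auto)
  define E where "E = En \<xi> \<Delta>"
  define a where "a p q = U p q * mix \<theta> p q / (E p + E q)" for p q
  define \<phi> where "\<phi> = two_pairs a"
  define N where "N = nrm ks \<xi> U \<Delta> \<theta>"
  have E_nonneg: "E k \<ge> 0" for k by (simp add: E_def En_def)
  have xi_even: "\<xi> (-k) = \<xi> k" for k by (simp add: xi xi_def)
  have a_sym: "a q p = a p q" if "p \<in> set ks" "q \<in> set ks" for p q
    using U_sym[of p q] that order(1) by (simp add: a_def mix_commute[of _ q] add.commute)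
  have a_diag: "a p p = 0" if "p \<in> set ks" for p
    using U_diag[of p] that order(1) by (simp add: a_def)
  have Ud: "U k k = 0" if "k \<in> set ks" for k
    using U_diag that order(1) by simp
  have E_cos: "\<xi> k = E k * cos (2 * \<theta> k)" and E_sin: "\<Delta> k = E k * sin (2 * \<theta> k)"
    and cos_sin: "cos (\<theta> k) * sin (\<theta> k) = \<Delta> k / (2 * E k)" if "k \<in> set ks" for k
  proof -
    have k: "k \<in> Lam L Kmax" using that order(1) by simp
    have "\<xi> k = E k * cos (2 * \<theta> k) \<and> \<Delta> k = E k * sin (2 * \<theta> k)
        \<and> cos (\<theta> k) * sin (\<theta> k) = \<Delta> k / (2 * E k)"
    \<comment> \<open>In the exceptional case \<open>E k = 0\<close>, and
      \<open>\<Delta> k / (2 * E k)\<close> is 0 by convention, in agreement with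
      \<open>cos (\<theta> k) = 0\<close>.\<close>
    proof (cases "(\<forall>q\<in>Lam L Kmax. \<Delta> q = 0) \<and> \<xi> k = 0")
      case True
      with theta_normal[of k] k have "\<theta> k = pi / 2" by blast
      then have "cos (\<theta> k) = 0" by (simp only: cos_pi_half)
      then show ?thesis using True k by (simp add: E_def En_def)
    next
      case False
      have "cos (\<theta> k) * sin (\<theta> k) = sin (2 * \<theta> k) / 2" by (simp add: sin_double)
      then show ?thesis
        using theta[OF k False] by (simp del: sin_double add: E_def En_def)
    qed
    then show "\<xi> k = E k * cos (2 * \<theta> k)" "\<Delta> k = E k * sin (2 * \<theta> k)"
      "cos (\<theta> k) * sin (\<theta> k) = \<Delta> k / (2 * E k)" by blast+
  qed
  have gap': "\<Delta> k = - (\<Sum>p\<in>set ks. U k p * (cos (\<theta> p) * sin (\<theta> p)))" if "k \<in> set ks" for k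
  proof -
    have "\<Delta> k = - (1/2) * (\<Sum>p\<in>set ks. U k p * \<Delta> p / E p)"
      using gap[of k] that by (simp add: order(1) E_def En_def)
    also have "\<dots> = - (\<Sum>p\<in>set ks. U k p * (cos (\<theta> p) * sin (\<theta> p)))"
      unfolding sum_distrib_left sum_negf[symmetric] by (intro sum.cong refl) (simp add: cos_sin)
    finally show ?thesis .
  qed
  have m: "U p q * mix \<theta> p q = (E p + E q) * a p q" if "p \<in> set ks" "q \<in> set ks" for p q
    using m'[OF that] by (simp only: E_def a_def)
  have U_sym': "U q p = U p q" if "p \<in> set ks" "q \<in> set ks" for p q
    using U_sym[of p q] that order(1) by simp
  have Phi: "Phi ks \<xi> U \<Delta> \<theta> = V \<theta> \<phi>"
    by (simp add: Phi_eq \<phi>_def a_def[abs_def] E_def)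
  have norm_\<phi>: "ip ks \<phi> \<phi> = of_real (N - 1)" "N > 0"
  proof -
    define s where "s = (\<Sum>n\<in>configs ks. (cmod (\<phi> n))\<^sup>2)"
    have s: "ip ks \<phi> \<phi> = of_real s"
      unfolding ip_def s_def of_real_sum
      by (intro sum.cong refl) (metis complex_norm_square mult.commute)
    have "N = 1 + s"
      by (simp add: N_def nrm_def Phi ip_V_V s)
    moreover have "s \<ge> 0" by (auto simp: s_def intro: sum_nonneg)
    ultimately show "ip ks \<phi> \<phi> = of_real (N - 1)" "N > 0" using s by simp_all
  qed
  \<comment> \<open>\<open>E0\<close> will be the BCS energy, and \<open>D\<close> is
    \<open>DeltaE\<close> before division by the normalisation \<open>N\<close>.\<close>
  define E0 where "E0 = (\<Sum>k\<in>set ks. 2 * \<xi> k * (sin (\<theta> k))\<^sup>2)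
    + (\<Sum>k\<in>set ks. \<Sum>k'\<in>set ks. U k k' * (cos (\<theta> k) * sin (\<theta> k) * (cos (\<theta> k') * sin (\<theta> k'))))"
  define T where "T j k = (\<Sum>q\<in>set ks. a j q * a k q)" for j k
  define D where "D = (\<Sum>k\<in>set ks. \<Sum>k'\<in>set ks. U k k'
        * ((cos (\<theta> k))\<^sup>2 * (cos (\<theta> k'))\<^sup>2 + (sin (\<theta> k))\<^sup>2 * (sin (\<theta> k'))\<^sup>2) * T k k')
      + 4 * (\<Sum>k\<in>set ks. \<Sum>k'\<in>set ks. U k k' * (cos (\<theta> k) * sin (\<theta> k) * (cos (\<theta> k') * sin (\<theta> k')))
          * (a k k')\<^sup>2)"
  have trial: "energy ks \<xi> U (V \<theta> (of_real X \<odot> vac + of_real Y \<odot> \<phi>)) = of_real (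
      (\<Sum>k\<in>set ks. 2 * \<xi> k * ((sin (\<theta> k))\<^sup>2 + ((cos (\<theta> k))\<^sup>2 - (sin (\<theta> k))\<^sup>2) * (Y\<^sup>2 * T k k)))
    + (\<Sum>k\<in>set ks. \<Sum>k'\<in>set ks. U k k' *
        (cos (\<theta> k) * sin (\<theta> k) * (cos (\<theta> k') * sin (\<theta> k'))
          * (1 - 2 * Y\<^sup>2 * T k k - 2 * Y\<^sup>2 * T k' k' + 4 * Y\<^sup>2 * (a k k')\<^sup>2)
        + ((cos (\<theta> k))\<^sup>2 * (cos (\<theta> k'))\<^sup>2 + (sin (\<theta> k))\<^sup>2 * (sin (\<theta> k'))\<^sup>2) * (Y\<^sup>2 * T k k')
        - mix \<theta> k k' * (X * Y * a k k'))))"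
    if "of_real (X\<^sup>2) + of_real (Y\<^sup>2) * ip ks \<phi> \<phi> = 1" for X Y
    using a_sym a_diag xi_even Ud that unfolding \<phi>_def T_def by (rule energy_trial)
  have trial_eq: "(\<Sum>k\<in>set ks. 2 * \<xi> k * ((sin (\<theta> k))\<^sup>2 + ((cos (\<theta> k))\<^sup>2 - (sin (\<theta> k))\<^sup>2) * (y * T k k)))
    + (\<Sum>k\<in>set ks. \<Sum>k'\<in>set ks. U k k' *
        (cos (\<theta> k) * sin (\<theta> k) * (cos (\<theta> k') * sin (\<theta> k'))
          * (1 - 2 * y * T k k - 2 * y * T k' k' + 4 * y * (a k k')\<^sup>2)
        + ((cos (\<theta> k))\<^sup>2 * (cos (\<theta> k'))\<^sup>2 + (sin (\<theta> k))\<^sup>2 * (sin (\<theta> k'))\<^sup>2) * (y * T k k')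
        - mix \<theta> k k' * (y * a k k')))
      = E0 + y * D" for y
    using a_sym U_sym' gap' E_cos E_sin m unfolding E0_def D_def T_def by (rule trial_energy_eq)
  have BCS: "energy ks \<xi> U (Psi_BCS ks \<theta>) = of_real E0"
    using trial[of 1 0]
    by (simp add: Psi_BCS_eq E0_def)
  define y where "y = 1 / sqrt N"
  have y2: "y\<^sup>2 = 1 / N" "y * y = 1 / N"
    using norm_\<phi>(2) by (simp_all add: y_def power_divide)
  have "of_real (y\<^sup>2) + of_real (y\<^sup>2) * ip ks \<phi> \<phi> = 1"
    unfolding norm_\<phi> y2 using norm_\<phi>(2) by (simp add: field_simps)
  note norm = this
  \<comment> \<open>Vacuum and excited part have the same amplitude \<open>y\<close>, so the
    interference weight \<open>X * Y\<close> is the same \<open>y * y\<close> as the excitation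
    weight, as \<open>trial_eq\<close> requires.\<close>
  have Psi: "Psi ks \<xi> U \<Delta> \<theta> = V \<theta> (of_real y \<odot> vac + of_real y \<odot> \<phi>)"
    unfolding Psi_def Phi Psi_BCS_eq lin_V[THEN lin_add] lin_V[THEN lin_smul] N_def[symmetric] y_def
    by (rule ext) (simp add: algebra_simps)
  have T_eq: "(\<Sum>p\<in>set ks. U k p * U k' p * mix \<theta> k p * mix \<theta> k' p
      / ((En \<xi> \<Delta> k + En \<xi> \<Delta> p) * (En \<xi> \<Delta> k' + En \<xi> \<Delta> p))) = T k k'" for k k'
    unfolding T_def by (intro sum.cong refl) (simp add: a_def E_def mult_ac)
  have a2_eq: "(U k k')\<^sup>2 * (mix \<theta> k k')\<^sup>2 / (En \<xi> \<Delta> k + En \<xi> \<Delta> k')\<^sup>2 = (a k k')\<^sup>2" for k k'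
    by (simp add: a_def E_def power_mult_distrib power_divide)
  have DeltaE_eq: "DeltaE ks \<xi> U \<Delta> \<theta> = D / N"
  proof -
    have split: "(x + 4 * z) / N = x / N + 4 * (z / N)" for x z
      by (simp add: add_divide_distrib)
    show ?thesis
      unfolding DeltaE_def T_eq a2_eq D_def N_def[symmetric] split sum_divide_distrib
      by (intro arg_cong2[where f = "(+)"] arg_cong[where f = "(*) 4"] sum.cong refl) simp_all
  qed
  have Psi_energy: "energy ks \<xi> U (Psi ks \<xi> U \<Delta> \<theta>) = of_real (E0 + DeltaE ks \<xi> U \<Delta> \<theta>)"
    unfolding Psi trial[OF norm] power2_eq_square[of y, symmetric] trial_eq DeltaE_eq y2 by simp
  have F: "Psi_F ks \<xi> = pair_state (filter (\<lambda>k. \<xi> k \<le> 0) ks)"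
    by (simp add: Psi_F_def pair_state_def Bc_def[abs_def])
  have Psi_F: "energy ks \<xi> U (Psi_F ks \<xi>) = of_real (\<Sum>k\<in>set ks. if \<xi> k \<le> 0 then 2 * \<xi> k else 0)"
    unfolding F using energy_pair_state[of "filter (\<lambda>k. \<xi> k \<le> 0) ks" \<xi> U] order(2) xi_even Ud
    by (simp add: sum.inter_filter)
  \<comment> \<open>The gap equation evaluates the inner interaction sum, so that the comparison
    with the normal state can be made label by label.\<close>
  have "E0 = (\<Sum>k\<in>set ks. 2 * \<xi> k * (sin (\<theta> k))\<^sup>2 - cos (\<theta> k) * sin (\<theta> k) * \<Delta> k)"
  proof -
    have "(\<Sum>k\<in>set ks. \<Sum>k'\<in>set ks. U k k' * (cos (\<theta> k) * sin (\<theta> k) * (cos (\<theta> k') * sin (\<theta> k'))))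
        = (\<Sum>k\<in>set ks. - (cos (\<theta> k) * sin (\<theta> k) * \<Delta> k))"
    proof (intro sum.cong refl)
      fix k assume "k \<in> set ks"
      show "(\<Sum>k'\<in>set ks. U k k' * (cos (\<theta> k) * sin (\<theta> k) * (cos (\<theta> k') * sin (\<theta> k'))))
          = - (cos (\<theta> k) * sin (\<theta> k) * \<Delta> k)"
        unfolding gap'[OF \<open>k \<in> set ks\<close>] by (simp add: sum_distrib_left mult_ac)
    qed
    then show ?thesis by (simp add: E0_def sum_subtractf sum_negf)
  qed
  also have "\<dots> \<le> (\<Sum>k\<in>set ks. if \<xi> k \<le> 0 then 2 * \<xi> k else 0)"
  proof (rule sum_mono)
    fix k assume k: "k \<in> set ks"
    have "E k = sqrt ((\<xi> k)\<^sup>2 + (\<Delta> k)\<^sup>2)" by (simp add: E_def En_def)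
    then show "2 * \<xi> k * (sin (\<theta> k))\<^sup>2 - cos (\<theta> k) * sin (\<theta> k) * \<Delta> k
        \<le> (if \<xi> k \<le> 0 then 2 * \<xi> k else 0)"
      using E_cos[OF k] E_sin[OF k] by (rule ground_energy_le)
  qed
  finally have E0_le: "E0 \<le> (\<Sum>k\<in>set ks. if \<xi> k \<le> 0 then 2 * \<xi> k else 0)" .
  have neg: "DeltaE ks \<xi> U \<Delta> \<theta> < 0" if coupled: "coupled ks \<xi> U \<Delta>"
  proof -
    let ?d = "\<lambda>k. cos (\<theta> k) * sin (\<theta> k)"
    let ?h = "\<lambda>k k'. (cos (\<theta> k))\<^sup>2 * (cos (\<theta> k'))\<^sup>2 + (sin (\<theta> k))\<^sup>2 * (sin (\<theta> k'))\<^sup>2"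
    let ?f = "\<lambda>k k'. U k k' * ?h k k' * T k k'"
    let ?g = "\<lambda>k k'. U k k' * (?d k * ?d k') * (a k k')\<^sup>2"
    have U_le: "U p q \<le> 0" if "p \<in> set ks" "q \<in> set ks" for p q
      using U_nonpos that order(1) by simp
    have d_nonneg: "?d k \<ge> 0" if "k \<in> set ks" for k
      using Delta_nonneg[of k] E_nonneg[of k] that order(1) by (simp add: cos_sin)
    have aa_nonneg: "a p q * a p' q \<ge> 0" if "p \<in> set ks" "p' \<in> set ks" "q \<in> set ks" for p p' q
    proof (rule mult_nonpos_nonpos)
      show "a p q \<le> 0" "a p' q \<le> 0"
        using U_le that E_nonneg mix_nonneg
        by (auto simp: a_def intro!: divide_nonpos_nonneg mult_nonpos_nonneg)
    qed
    have T_nonneg: "T k k' \<ge> 0" if "k \<in> set ks" "k' \<in> set ks" for k k'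
      unfolding T_def using aa_nonneg that by (intro sum_nonneg) auto
    have f_le: "?f k k' \<le> 0" if "k \<in> set ks" "k' \<in> set ks" for k k'
      using U_le[OF that] T_nonneg[OF that] by (intro mult_nonpos_nonneg) auto
    have g_le: "?g k k' \<le> 0" if "k \<in> set ks" "k' \<in> set ks" for k k'
      using that by (intro mult_nonpos_nonneg[OF mult_nonpos_nonneg[OF U_le mult_nonneg_nonneg]]
          d_nonneg zero_le_power2)
    have "D < 0"
    proof (cases "\<exists>k\<in>set ks. \<Delta> k \<noteq> 0")
      \<comment> \<open>For a nonzero gap the second sum of \<open>D\<close> is strictly negative:
        the gap equation at \<open>k\<close> provides some \<open>p\<close> coupled to
        \<open>k\<close> with a nonzero product of cosine and sine.\<close>
      case True
      then obtain k where k: "k \<in> set ks" "\<Delta> k \<noteq> 0" by blast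
      with gap'[OF k(1)] have "(\<Sum>p\<in>set ks. U k p * ?d p) \<noteq> 0" by simp
      then obtain p where "p \<in> set ks" "U k p * ?d p \<noteq> 0"
        by (rule sum.not_neutral_contains_not_neutral)
      then have p: "p \<in> set ks" "U k p \<noteq> 0" "?d p \<noteq> 0" by simp_all
      have E: "E k > 0" using E_sin[OF k(1)] k(2) E_nonneg[of k] by (cases "E k = 0") auto
      then have dk: "?d k \<noteq> 0" using cos_sin[OF k(1)] k(2) by simp
      have "mix \<theta> k p > 0" using dk p(3) by (auto simp: mix_def intro!: add_pos_nonneg)
      then have "a k p \<noteq> 0" using p(2) E E_nonneg[of p] by (simp add: a_def)
      then have "(a k p)\<^sup>2 > 0" by simp
      moreover have "?d k > 0" "?d p > 0" "U k p < 0"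
        using dk p d_nonneg[OF k(1)] d_nonneg[OF p(1)] U_le[OF k(1) p(1)] by linarith+
      ultimately have "?g k p < 0"
        by (intro mult_neg_pos[OF mult_neg_pos[OF _ mult_pos_pos]])
      then have "(\<Sum>k\<in>set ks. \<Sum>k'\<in>set ks. ?g k k') < 0"
        using g_le k(1) p(1) by (intro double_sum_neg) auto
      moreover have "(\<Sum>k\<in>set ks. \<Sum>k'\<in>set ks. ?f k k') \<le> 0"
        using f_le by (intro sum_nonpos) auto
      ultimately show ?thesis unfolding D_def by linarith
    next
      \<comment> \<open>For zero gap every angle has squared cosine 0 or 1 according to the side of
        the Fermi surface, and the coupled triple makes a summand of the first sum strictly
        negative.\<close>
      case False
      then obtain k k' p where k: "k \<in> set ks" "k' \<in> set ks" "p \<in> set ks"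
        and side: "\<xi> k \<le> 0 \<longleftrightarrow> \<xi> k' \<le> 0" "\<xi> k \<le> 0 \<longleftrightarrow> \<not> \<xi> p \<le> 0"
        and U: "U k k' \<noteq> 0" "U k p \<noteq> 0" "U k' p \<noteq> 0"
        using coupled unfolding coupled_def by blast
      have E_abs: "E q = \<bar>\<xi> q\<bar>" if "q \<in> set ks" for q
        using False that by (simp add: E_def En_def)
      have c: "(cos (\<theta> q))\<^sup>2 = (if \<xi> q \<le> 0 then 0 else 1)" if "q \<in> set ks" for q
      proof (cases "\<xi> q = 0")
        case True
        then have "\<theta> q = pi / 2"
          using theta_normal[of q] False that order(1) by auto
        then have "cos (\<theta> q) = 0" by (simp only: cos_pi_half)
        then show ?thesis using True by simp
      next
        case nz: False
        then have "cos (2 * \<theta> q) = \<xi> q / \<bar>\<xi> q\<bar>"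
          using E_cos[OF that] unfolding E_abs[OF that]
          by (metis abs_eq_0 nonzero_mult_div_cancel_left)
        also have "\<dots> = (if \<xi> q \<le> 0 then -1 else 1)"
          using nz by (simp add: abs_if)
        finally have "cos (2 * \<theta> q) = (if \<xi> q \<le> 0 then -1 else 1)" .
        then show ?thesis using cos_double_cos[of "\<theta> q"] by (auto split: if_splits)
      qed
      have s: "(sin (\<theta> q))\<^sup>2 = (if \<xi> q \<le> 0 then 1 else 0)" if "q \<in> set ks" for q
        using c[OF that] sin_squared_eq[of "\<theta> q"] by auto
      have "?h k k' = 1" using c s k side by auto
      moreover have "T k k' > 0"
        unfolding T_def
      proof (rule sum_pos2)
        have "mix \<theta> k p = 1" "mix \<theta> k' p = 1" using c s k side by (auto simp: mix_def)
        \<comment> \<open>Opposite sides of the Fermi surface: one of the two energies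
          \<open>\<xi>\<close> is strictly positive.\<close>
        moreover have "E k + E p > 0" "E k' + E p > 0" using E_abs k side by auto
        ultimately have "a k p \<noteq> 0" "a k' p \<noteq> 0" using U by (auto simp: a_def)
        then show "0 < a k p * a k' p" using aa_nonneg[OF k] by (simp add: order.strict_iff_order)
      qed (use k aa_nonneg in auto)
      moreover have "U k k' < 0" using U(1) U_le[OF k(1,2)] by simp
      ultimately have "?f k k' < 0" by (simp add: mult_neg_pos)
      then have "(\<Sum>k\<in>set ks. \<Sum>k'\<in>set ks. ?f k k') < 0"
        using f_le k by (intro double_sum_neg) auto
      moreover have "(\<Sum>k\<in>set ks. \<Sum>k'\<in>set ks. ?g k k') \<le> 0"
        using g_le by (intro sum_nonpos) auto
      ultimately show ?thesis unfolding D_def by linarith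
    qed
    then show ?thesis
      unfolding DeltaE_eq using norm_\<phi>(2) by (simp add: divide_neg_pos)
  qed
  \<comment> \<open>The order on complex numbers asks for equal imaginary parts; all three energies
    are real.\<close>
  show ?thesis
    unfolding Psi_energy BCS Psi_F using neg E0_le by (auto simp: less_complex_def)
qed

end
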